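(* Let $\varphi$ be a Grassmann–Plücker function (resp. weak Grassmann–Plücker function) of rank $r$ on a finite set $E$ with coefficients in a hyperfield $F$. Then $\mathcal{C}_\varphi\subseteq F^E$ satisfies the strong modular elimination axiom (C3) (resp. the weak modular elimination axiom (C3)$'$).
   Context: Hyperfield $(F,\odot,\boxplus,1,0)$: commutative associative hyperoperation ($A\boxplus B=\bigcup a\boxplus b$, iterated sums recursive) with $0\boxplus x=\{x\}$, unique $-x$ with $0\in x\boxplus(-x)$, $x\in y\boxplus z\iff z\in x\boxplus(-y)$; commutative monoid $(F,\odot,1)$, $0\odot x=0$, distributivity, $0\ne1$, non-zero elements invertible. Support $\underline X=\{e:X(e)\ne0\}$. (Weak) Grassmann–Plücker functions of rank $r$: $\varphi:E^r\to F$ not identically zero, alternating (swap multiplies by $-1$; zero on repeated arguments), with $0\in\boxplus_{k=1}^{r+1}(-1)^k\varphi(x_1,..,\widehat{x_k},..,x_{r+1})\odot\varphi(x_k,y_1,..,y_{r-1})$ for all distinct $x_1..x_{r+1}$ and distinct $y_1..y_{r-1}$ (strong), resp. only when $|\{x_i\}\setminus\{y_j\}|=3$ and with support $\{\{x_1..x_r\}:\varphi\ne0\}$ the bases of a rank $r$ matroid (weak); $\underline M_\varphi$ is the matroid with these bases. $\mathcal{C}_\varphi$: all $X\in F^E$ with $\underline X$ a circuit of $\underline M_\varphi$ and $X(f)/X(e)=-\varphi(e,x_2..x_r)/\varphi(f,x_2..x_r)$ for all $e,f$ and every basis $\{f,x_2..x_r\}\supseteq\underline X\setminus e$. Modular families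 in $\mathcal{C}\subseteq F^E$: elements with distinct supports form a modular family of size $k$ if the union of their supports has height $k$ (length of longest strict chain ending there) in the lattice of all unions of supports of elements of $\mathcal{C}$, ordered by inclusion; modular pair: $k=2$. (C3)$'$: if $X,Y\in\mathcal{C}$ form a modular pair and $X(e)=-Y(e)\ne0$, some $Z\in\mathcal{C}$ has $Z(e)=0$ and $Z(f)\in X(f)\boxplus Y(f)$ for all $f$. (C3): if $X_1,\dots,X_k,X\in\mathcal{C}$ ($k\ge1$) form a modular family of size $k+1$, $\underline X\not\subseteq\bigcup\underline X_i$, and $e_i\in(\underline X\cap\underline X_i)\setminus\bigcup_{j\ne i}\underline X_j$ with $X(e_i)=-X_i(e_i)\neq0$, then some $Z\in\mathcal{C}$ has $Z(e_i)=0$ for all $i$ and $Z(f)\in X(f)\boxplus X_1(f)\boxplus\cdots\boxplus X_k(f)$ for all $f$. *)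

theory Defs
  imports "HOL-Library.FuncSet"
begin

section \<open>Hyperfields\<close>

text \<open>
  The underlying set of the hyperfield is the whole type. Negation and inversion are uniquely
  determined by the other operations; as in \<^class>\<open>field\<close>, the inverse of zero is set to zero.
\<close>

class hyperfield = comm_monoid_mult + mult_zero + zero_neq_one + uminus + inverse +
  fixes hadd :: "'a \<Rightarrow> 'a \<Rightarrow> 'a set"  (infixl "\<boxplus>" 65)
  assumes hadd_nonempty: "x \<boxplus> y \<noteq> {}"
    and hadd_commute: "x \<boxplus> y = y \<boxplus> x"
    and hadd_assoc: "(\<Union>u\<in>x \<boxplus> y. u \<boxplus> z) = (\<Union>u\<in>y \<boxplus> z. x \<boxplus> u)"
    and hadd_zero_left: "0 \<boxplus> x = {x}"
    and zero_in_hadd_uminus: "0 \<in> x \<boxplus> (- x)"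
    and uminus_unique: "0 \<in> x \<boxplus> y \<Longrightarrow> y = - x"
    and hadd_reversible: "x \<in> y \<boxplus> z \<longleftrightarrow> z \<in> x \<boxplus> (- y)"
    and hadd_distrib_left: "(\<lambda>u. x * u) ` (y \<boxplus> z) = (x * y) \<boxplus> (x * z)"
    and inverse_right: "x \<noteq> 0 \<Longrightarrow> x * inverse x = 1"
    and inverse_zero_eq: "inverse 0 = 0"
    and divide_eq_mult_inverse: "x / y = x * inverse y"

text \<open>By \<open>0 \<boxplus> x = {x}\<close>, the sum of a one-element list is the singleton of its entry.\<close>

fun hsum :: "'f::hyperfield list \<Rightarrow> 'f set" where
  "hsum [] = {0}"
| "hsum (x # xs) = (\<Union>u\<in>hsum xs. x \<boxplus> u)"


section \<open>Matroids given by their bases\<close>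

definition matroid_bases :: "'a set \<Rightarrow> nat \<Rightarrow> 'a set set \<Rightarrow> bool" where
  "matroid_bases E r \<B> \<longleftrightarrow>
     \<B> \<noteq> {} \<and> (\<forall>B\<in>\<B>. B \<subseteq> E \<and> card B = r) \<and>
     (\<forall>A\<in>\<B>. \<forall>B\<in>\<B>. \<forall>a\<in>A - B. \<exists>b\<in>B - A. insert b (A - {a}) \<in> \<B>)"

definition dependent_wrt :: "'a set set \<Rightarrow> 'a set \<Rightarrow> bool" where
  "dependent_wrt \<B> D \<longleftrightarrow> \<not> (\<exists>B\<in>\<B>. D \<subseteq> B)"

definition circuits :: "'a set \<Rightarrow> 'a set set \<Rightarrow> 'a set set" where
  "circuits E \<B> = {C. C \<subseteq> E \<and> dependent_wrt \<B> C \<and> (\<forall>D. D \<subset> C \<longrightarrow> \<not> dependent_wrt \<B> D)}"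


section \<open>Grassmann--Pluecker functions\<close>

text \<open>
  A function on $E^r$ is a function on lists of which only the values on lists of length \<open>r\<close> with
  entries in \<open>E\<close> matter.
\<close>

definition tuples :: "'a set \<Rightarrow> nat \<Rightarrow> 'a list set" where
  "tuples E r = {xs. set xs \<subseteq> E \<and> length xs = r}"

definition alternating :: "'a set \<Rightarrow> nat \<Rightarrow> ('a list \<Rightarrow> 'f::hyperfield) \<Rightarrow> bool" where
  "alternating E r \<phi> \<longleftrightarrow>
     (\<forall>xs\<in>tuples E r.
        (\<forall>i<r. \<forall>j<r. i \<noteq> j \<longrightarrow> \<phi> (xs[i := xs ! j, j := xs ! i]) = (-1) * \<phi> xs) \<and>
        (\<not> distinct xs \<longrightarrow> \<phi> xs = 0))"

text \<open>
  The index \<open>k\<close> runs from \<open>1\<close> to \<open>r + 1\<close>, so the entry $x_k$ is \<open>xs ! (k - 1)\<close>.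
\<close>

definition gp_relation ::
    "nat \<Rightarrow> ('a list \<Rightarrow> 'f::hyperfield) \<Rightarrow> 'a list \<Rightarrow> 'a list \<Rightarrow> bool" where
  "gp_relation r \<phi> xs ys \<longleftrightarrow>
     0 \<in> hsum (map (\<lambda>k. (-1) ^ k * \<phi> (take (k - 1) xs @ drop k xs) * \<phi> (xs ! (k - 1) # ys))
                [1..<r + 2])"

text \<open>
  The second tuple is constrained by \<open>length ys + 1 = r\<close> rather than by \<open>length ys = r - 1\<close>,
  because subtraction is truncated; in rank \<open>0\<close> there are then no relations.
\<close>

definition grassmann_pluecker :: "'a set \<Rightarrow> nat \<Rightarrow> ('a list \<Rightarrow> 'f::hyperfield) \<Rightarrow> bool" where
  "grassmann_pluecker E r \<phi> \<longleftrightarrow>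
     (\<exists>xs\<in>tuples E r. \<phi> xs \<noteq> 0) \<and>
     alternating E r \<phi> \<and>
     (\<forall>xs ys. set xs \<subseteq> E \<and> length xs = r + 1 \<and> distinct xs \<and>
        set ys \<subseteq> E \<and> length ys + 1 = r \<and> distinct ys \<longrightarrow> gp_relation r \<phi> xs ys)"

definition gp_bases :: "'a set \<Rightarrow> nat \<Rightarrow> ('a list \<Rightarrow> 'f::hyperfield) \<Rightarrow> 'a set set" where
  "gp_bases E r \<phi> = {set xs | xs. xs \<in> tuples E r \<and> \<phi> xs \<noteq> 0}"

definition weak_grassmann_pluecker ::
    "'a set \<Rightarrow> nat \<Rightarrow> ('a list \<Rightarrow> 'f::hyperfield) \<Rightarrow> bool" where
  "weak_grassmann_pluecker E r \<phi> \<longleftrightarrow>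
     (\<exists>xs\<in>tuples E r. \<phi> xs \<noteq> 0) \<and>
     alternating E r \<phi> \<and>
     matroid_bases E r (gp_bases E r \<phi>) \<and>
     (\<forall>xs ys. set xs \<subseteq> E \<and> length xs = r + 1 \<and> distinct xs \<and>
        set ys \<subseteq> E \<and> length ys + 1 = r \<and> distinct ys \<and> card (set xs - set ys) = 3 \<longrightarrow>
        gp_relation r \<phi> xs ys)"


section \<open>The set of vectors attached to a Grassmann--Pluecker function\<close>

definition supp :: "'a set \<Rightarrow> ('a \<Rightarrow> 'f::zero) \<Rightarrow> 'a set" where
  "supp E X = {e\<in>E. X e \<noteq> 0}"

text \<open>
  The ratio condition is vacuous for \<open>X e = 0\<close> and for \<open>e = f\<close>: in these cases the basis would
  contain the circuit \<open>supp E X\<close>.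
\<close>

definition gp_circuits :: "'a set \<Rightarrow> nat \<Rightarrow> ('a list \<Rightarrow> 'f::hyperfield) \<Rightarrow> ('a \<Rightarrow> 'f) set" where
  "gp_circuits E r \<phi> =
     {X \<in> E \<rightarrow>\<^sub>E UNIV.
        supp E X \<in> circuits E (gp_bases E r \<phi>) \<and>
        (\<forall>e\<in>E. \<forall>f\<in>E. \<forall>xs. f # xs \<in> tuples E r \<and> set (f # xs) \<in> gp_bases E r \<phi> \<and>
            supp E X - {e} \<subseteq> set (f # xs) \<longrightarrow>
            X f / X e = - (\<phi> (e # xs) / \<phi> (f # xs)))}"


section \<open>Modular elimination\<close>

text \<open>The empty union is included, so the least element is the empty set, of height \<open>0\<close>.\<close>

definition support_unions :: "'a set \<Rightarrow> ('a \<Rightarrow> 'f::zero) set \<Rightarrow> 'a set set" where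
  "support_unions E \<C> = {\<Union>\<S> | \<S>. \<S> \<subseteq> supp E ` \<C>}"

text \<open>
  The length of a chain is its number of steps: \<open>cs @ [u]\<close> is a chain of length \<open>length cs\<close>
  ending in \<open>u\<close>.
\<close>

definition height :: "'a set set \<Rightarrow> 'a set \<Rightarrow> nat" where
  "height \<L> u = Max {length cs | cs. set cs \<subseteq> \<L> \<and> sorted_wrt (\<subset>) (cs @ [u])}"

definition modular_family ::
    "'a set \<Rightarrow> ('a \<Rightarrow> 'f::zero) set \<Rightarrow> ('a \<Rightarrow> 'f) list \<Rightarrow> bool" where
  "modular_family E \<C> Xs \<longleftrightarrow>
     set Xs \<subseteq> \<C> \<and> distinct (map (supp E) Xs) \<and>
     height (support_unions E \<C>) (\<Union>X\<in>set Xs. supp E X) = length Xs"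

definition weak_modular_elimination :: "'a set \<Rightarrow> ('a \<Rightarrow> 'f::hyperfield) set \<Rightarrow> bool" where
  "weak_modular_elimination E \<C> \<longleftrightarrow>
     (\<forall>X Y. \<forall>e\<in>E. modular_family E \<C> [X, Y] \<and> X e = - Y e \<and> X e \<noteq> 0 \<longrightarrow>
        (\<exists>Z\<in>\<C>. Z e = 0 \<and> (\<forall>f\<in>E. Z f \<in> X f \<boxplus> Y f)))"

definition strong_modular_elimination :: "'a set \<Rightarrow> ('a \<Rightarrow> 'f::hyperfield) set \<Rightarrow> bool" where
  "strong_modular_elimination E \<C> \<longleftrightarrow>
     (\<forall>Xs X es.
        length Xs \<ge> 1 \<and> length es = length Xs \<and>
        modular_family E \<C> (Xs @ [X]) \<and>
        \<not> supp E X \<subseteq> (\<Union>Y\<in>set Xs. supp E Y) \<and>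
        (\<forall>i<length Xs.
           es ! i \<in> (supp E X \<inter> supp E (Xs ! i)) - (\<Union>j\<in>{..<length Xs} - {i}. supp E (Xs ! j)) \<and>
           X (es ! i) = - (Xs ! i) (es ! i) \<and> X (es ! i) \<noteq> 0) \<longrightarrow>
        (\<exists>Z\<in>\<C>. (\<forall>i<length Xs. Z (es ! i) = 0) \<and>
           (\<forall>f\<in>E. Z f \<in> hsum (map (\<lambda>Y. Y f) (X # Xs)))))"

end

theory Submission
  imports Defs "HOL-Library.Multiset"
begin

text \<open>
  Let \<open>z\<close> be an element of the support of \<open>X\<close> outside the supports of the \<open>X\<^sub>i\<close>, and let \<open>U\<close> be the
  union of all supports. Modularity forces \<open>U - {z, e\<^sub>1, \<dots>, e\<^sub>k}\<close> to be independent. In a basis \<open>B\<close>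
  containing it, \<open>X\<^sub>i\<close> is the fundamental circuit of \<open>e\<^sub>i\<close>, and \<open>Z\<close> is taken to be the fundamental
  circuit of \<open>z\<close>, scaled so that \<open>Z z = X z\<close>. For \<open>f \<in> B\<close> let \<open>ys\<close> list \<open>B - {f}\<close>. The ratio conditions
  express \<open>Z f\<close> and \<open>X\<^sub>i f\<close> by \<open>\<phi> (z # ys)\<close> and \<open>\<phi> (e\<^sub>i # ys)\<close>, so that the inclusion wanted at \<open>f\<close>
  becomes the orthogonality of \<open>X\<close> and \<open>\<phi> (\<cdot> # ys)\<close>. This is the Grassmann--Pluecker relation for
  \<open>ys\<close> and a tuple completing the support of \<open>X\<close> inside \<open>B \<union> {z, e\<^sub>1, \<dots>, e\<^sub>k}\<close>. The two tuples differ in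
  at most \<open>k + 2\<close> entries, so for \<open>k = 1\<close> the relations of a weak Grassmann--Pluecker function suffice.
\<close>


section \<open>Arithmetic in hyperfields\<close>

lemma hyperfield_minus_one_mult: "(- 1) * x = - (x :: 'f::hyperfield)"
proof -
  have "x * 0 \<in> (\<lambda>u. x * u) ` (1 \<boxplus> (- 1))"
    using zero_in_hadd_uminus by blast
  then have "0 \<in> x \<boxplus> x * (- 1)"
    by (simp add: hadd_distrib_left)
  then show ?thesis
    using uminus_unique by (metis mult.commute)
qed

lemma hyperfield_minus_mult_left: "(- x) * y = - (x * y :: 'f::hyperfield)"
  by (metis hyperfield_minus_one_mult mult.assoc)

lemma hyperfield_minus_mult_right: "x * (- y) = - (x * y :: 'f::hyperfield)"
  by (metis hyperfield_minus_mult_left mult.commute)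

lemma hyperfield_minus_minus: "- (- x) = (x :: 'f::hyperfield)"
  by (metis hadd_commute uminus_unique zero_in_hadd_uminus)

lemma hyperfield_minus_zero: "- 0 = (0 :: 'f::hyperfield)"
  by (metis hyperfield_minus_one_mult mult_zero_right)

lemma hyperfield_minus_eq_0_iff: "- x = 0 \<longleftrightarrow> x = (0 :: 'f::hyperfield)"
  by (metis hyperfield_minus_minus hyperfield_minus_zero)

lemma hyperfield_inverse_left: "x \<noteq> 0 \<Longrightarrow> inverse x * x = (1 :: 'f::hyperfield)"
  by (metis inverse_right mult.commute)

lemma hyperfield_mult_cancel_left:
  fixes a :: "'f::hyperfield"
  assumes "a \<noteq> 0"
  shows "a * x = a * y \<longleftrightarrow> x = y"
  by (metis assms hyperfield_inverse_left mult.assoc mult_1)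

lemma hyperfield_mult_eq_0_iff: "x * y = 0 \<longleftrightarrow> x = 0 \<or> y = (0 :: 'f::hyperfield)"
  by (metis hyperfield_mult_cancel_left mult_zero_left mult_zero_right)

lemma hyperfield_divide_eq_iff:
  fixes a :: "'f::hyperfield"
  assumes "b \<noteq> 0"
  shows "a / b = c \<longleftrightarrow> a = c * b"
proof -
  have "c * b * inverse b = c"
    using assms by (simp add: mult.assoc inverse_right)
  moreover have "a * inverse b * b = a"
    using assms by (simp add: mult.assoc hyperfield_inverse_left)
  ultimately show ?thesis
    by (auto simp: divide_eq_mult_inverse)
qed

text \<open>Clears denominators in the ratio condition of \<open>gp_circuits\<close>, so that later
  arguments compare products only.\<close>

lemma hyperfield_divide_eq_minus_divide_iff:
  fixes a :: "'f::hyperfield"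
  assumes "b \<noteq> 0" "d \<noteq> 0"
  shows "a / b = - (c / d) \<longleftrightarrow> a * d = - (b * c)"
proof -
  have minus_swap: "x = - y \<longleftrightarrow> y = - x" for x y :: 'f
    using hyperfield_minus_minus by metis
  have "a / b = - (c / d) \<longleftrightarrow> c / d = - (a / b)"
    by (rule minus_swap)
  also have "\<dots> \<longleftrightarrow> c = - (a / b) * d"
    by (rule hyperfield_divide_eq_iff[OF assms(2)])
  also have "\<dots> \<longleftrightarrow> b * c = b * (- (a / b) * d)"
    using assms(1) by (simp add: hyperfield_mult_cancel_left)
  also have "b * (- (a / b) * d) = - (a / b * b * d)"
    by (simp add: hyperfield_minus_mult_left hyperfield_minus_mult_right mult_ac)
  also have "a / b * b = a"
    using hyperfield_divide_eq_iff[OF assms(1), of a "a / b"] by simp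
  also have "b * c = - (a * d) \<longleftrightarrow> a * d = - (b * c)"
    by (rule minus_swap)
  finally show ?thesis .
qed

lemma hyperfield_zero_divide: "0 / x = (0 :: 'f::hyperfield)"
  by (simp add: divide_eq_mult_inverse)

lemma hyperfield_minus_one_power_square: "(- 1 :: 'f::hyperfield) ^ n * (- 1) ^ n = 1"
  by (induction n) (simp_all add: hyperfield_minus_mult_left hyperfield_minus_mult_right
      hyperfield_minus_minus)

lemmas hyperfield_minus_simps =
  hyperfield_minus_mult_left hyperfield_minus_mult_right hyperfield_minus_minus
  hyperfield_minus_zero hyperfield_minus_eq_0_iff

section \<open>Hypersums of lists\<close>

lemma zero_in_hadd_iff: "0 \<in> x \<boxplus> y \<longleftrightarrow> y = - (x :: 'f::hyperfield)"
  using uminus_unique zero_in_hadd_uminus by blast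

lemma hsum_single: "hsum [x] = {x}"
  by (simp add: hadd_commute[of x 0] hadd_zero_left)

lemma hsum_pair: "hsum [x, y] = x \<boxplus> y"
  using hsum_single[of y] by simp

text \<open>The only negative of \<open>- x\<close> is \<open>x\<close>. Membership in a hypersum
  thus becomes a statement about zero, the form that Grassmann--Pluecker relations have.\<close>

lemma zero_in_hsum_minus_Cons_iff: "0 \<in> hsum (- x # xs) \<longleftrightarrow> x \<in> hsum xs"
  by (auto simp: zero_in_hadd_iff hyperfield_minus_minus)

lemma hsum_scale: "hsum (map ((*) c) xs) = (*) c ` hsum xs"
proof (induction xs)
  case (Cons x xs)
  have "hsum (map ((*) c) (x # xs)) = (\<Union>u\<in>hsum xs. c * x \<boxplus> c * u)"
    using Cons by simp
  also have "\<dots> = (*) c ` hsum (x # xs)"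
    by (simp add: hadd_distrib_left[symmetric] image_UN)
  finally show ?case .
qed simp

lemma zero_in_hsum_scale_iff:
  assumes "c \<noteq> 0"
  shows "0 \<in> hsum (map ((*) c) xs) \<longleftrightarrow> 0 \<in> hsum xs"
proof -
  have "c * x = 0 \<longleftrightarrow> x = 0" for x
    using assms by (simp add: hyperfield_mult_eq_0_iff)
  then show ?thesis
    unfolding hsum_scale image_iff by metis
qed

lemma hsum_swap: "hsum (x # y # xs) = hsum (y # x # xs)"
proof -
  have "hsum (a # b # xs) = (\<Union>u\<in>hsum xs. \<Union>v\<in>a \<boxplus> b. v \<boxplus> u)" for a b
    by (simp add: hadd_assoc)
  then show ?thesis
    by (simp only: hadd_commute[of x y])
qed

lemma hsum_Cons_cong: "hsum xs = hsum ys \<Longrightarrow> hsum (x # xs) = hsum (x # ys)"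
  by simp

lemma hsum_move: "hsum (xs @ x # ys) = hsum (x # xs @ ys)"
proof (induction xs)
  case (Cons a xs)
  have "hsum ((a # xs) @ x # ys) = hsum (a # x # xs @ ys)"
    using hsum_Cons_cong[OF Cons] by (metis append_Cons)
  then show ?case
    by (metis append_Cons hsum_swap)
qed simp

lemma hsum_mset_eq: "mset xs = mset ys \<Longrightarrow> hsum xs = hsum ys"
proof (induction xs arbitrary: ys)
  case (Cons x xs)
  have "x \<in> set ys"
    using Cons.prems by (metis list.set_intros(1) set_mset_mset)
  then obtain us vs where ys: "ys = us @ x # vs"
    using split_list by fastforce
  with Cons have "hsum xs = hsum (us @ vs)"
    by auto
  then show ?case
    using hsum_Cons_cong hsum_move ys by metis
qed simp

lemma hsum_filter_nonzero: "hsum (filter (\<lambda>x. x \<noteq> 0) xs) = hsum xs"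
  by (induction xs) (auto simp: hadd_zero_left)

text \<open>Zero is neutral and the order of the summands is irrelevant, so only nonzero terms
  count. This allows the sum over a tuple to be replaced by one over a more convenient list.\<close>

lemma hsum_map_cong_nonzero:
  assumes "distinct us" "distinct vs"
    and "{u \<in> set us. g u \<noteq> 0} = {v \<in> set vs. g v \<noteq> 0}"
  shows "hsum (map g us) = hsum (map g vs)"
proof -
  have "mset (filter (\<lambda>u. g u \<noteq> 0) us) = mset (filter (\<lambda>u. g u \<noteq> 0) vs)"
    using assms by (intro set_eq_iff_mset_eq_distinct[THEN iffD1]) auto
  then have "mset (filter (\<lambda>x. x \<noteq> 0) (map g us)) = mset (filter (\<lambda>x. x \<noteq> 0) (map g vs))"
    by (simp add: filter_map o_def)
  then show ?thesis
    by (metis hsum_mset_eq hsum_filter_nonzero)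
qed

lemma hsum_zeros: "\<forall>x\<in>set xs. x = 0 \<Longrightarrow> hsum xs = {0}"
  by (induction xs) (auto simp: hadd_zero_left)

lemma hsum_single_nonzero:
  assumes "i < length xs" "\<And>j. j < length xs \<Longrightarrow> j \<noteq> i \<Longrightarrow> xs ! j = 0"
  shows "hsum xs = {xs ! i}"
proof -
  have "hsum xs = hsum (take i xs @ xs ! i # drop (Suc i) xs)"
    by (rule arg_cong[OF id_take_nth_drop[OF assms(1)]])
  also have "\<dots> = hsum (xs ! i # take i xs @ drop (Suc i) xs)"
    by (rule hsum_move)
  also have "\<dots> = {xs ! i}"
  proof -
    have "\<forall>x\<in>set (take i xs @ drop (Suc i) xs). x = 0"
      using assms by (auto simp: in_set_conv_nth)
    then have "hsum (take i xs @ drop (Suc i) xs) = {0}"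
      by (rule hsum_zeros)
    then show ?thesis
      by (simp add: hadd_commute[of _ 0] hadd_zero_left)
  qed
  finally show ?thesis .
qed


section \<open>Bases and circuits\<close>

lemma matroid_basis_exchange:
  assumes "matroid_bases E r \<B>" "A \<in> \<B>" "B \<in> \<B>" "a \<in> A - B"
  obtains b where "b \<in> B - A" "insert b (A - {a}) \<in> \<B>"
proof -
  have "\<forall>A\<in>\<B>. \<forall>B\<in>\<B>. \<forall>a\<in>A - B. \<exists>b\<in>B - A. insert b (A - {a}) \<in> \<B>"
    using assms(1) by (simp add: matroid_bases_def)
  then show ?thesis
    using assms(2-4) that by blast
qed

text \<open>Elements of \<open>A\<close> outside \<open>S\<close> are exchanged one by one for
  elements of \<open>B\<close>, which lie in \<open>S\<close>; those of \<open>I\<close> are in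
  \<open>S\<close> and hence never removed.\<close>

lemma matroid_basis_between:
  assumes "matroid_bases E r \<B>" "finite E" "A \<in> \<B>" "B \<in> \<B>" "I \<subseteq> A" "I \<subseteq> S" "B \<subseteq> S"
  shows "\<exists>B'\<in>\<B>. I \<subseteq> B' \<and> B' \<subseteq> S"
  using assms(3,5)
proof (induction "card (A - S)" arbitrary: A rule: less_induct)
  case less
  show ?case
  proof (cases "A \<subseteq> S")
    case False
    then obtain a where a: "a \<in> A" "a \<notin> S"
      by blast
    then have "a \<in> A - B"
      using assms(7) by blast
    then obtain b where b: "b \<in> B - A" "insert b (A - {a}) \<in> \<B>"
      using matroid_basis_exchange[OF assms(1) less.prems(1) assms(4)] by blast
    have "A \<subseteq> E"
      using assms(1) less.prems(1) unfolding matroid_bases_def by simp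
    then have "finite A"
      using assms(2) finite_subset by blast
    moreover have "insert b (A - {a}) - S \<subset> A - S"
      using a b assms by auto
    ultimately have "card (insert b (A - {a}) - S) < card (A - S)"
      by (simp add: psubset_card_mono)
    moreover have "I \<subseteq> insert b (A - {a})"
      using a less.prems assms(6) by blast
    ultimately show ?thesis
      using less.hyps b(2) by blast
  qed (use less.prems in blast)
qed

lemma circuit_not_subset_basis: "C \<in> circuits E \<B> \<Longrightarrow> B \<in> \<B> \<Longrightarrow> \<not> C \<subseteq> B"
  by (auto simp: circuits_def dependent_wrt_def)

lemma circuit_delete_subset_basis:
  assumes "C \<in> circuits E \<B>" "c \<in> C"
  obtains B where "B \<in> \<B>" "C - {c} \<subseteq> B"
proof -
  have "C - {c} \<subset> C"
    using assms by blast
  then have "\<not> dependent_wrt \<B> (C - {c})"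
    using assms by (simp add: circuits_def)
  then show ?thesis
    using that by (auto simp: dependent_wrt_def)
qed

lemma circuit_subset_eq: "C \<in> circuits E \<B> \<Longrightarrow> D \<in> circuits E \<B> \<Longrightarrow> C \<subseteq> D \<Longrightarrow> C = D"
  by (auto simp: circuits_def)

lemma dependent_contains_circuit:
  assumes "finite E" "D \<subseteq> E" "dependent_wrt \<B> D"
  obtains C where "C \<in> circuits E \<B>" "C \<subseteq> D"
proof -
  have "finite D"
    using assms finite_subset by blast
  then have "D \<subseteq> E \<Longrightarrow> dependent_wrt \<B> D \<Longrightarrow> \<exists>C\<in>circuits E \<B>. C \<subseteq> D"
  proof (induction D rule: finite_psubset_induct)
    case (psubset D)
    show ?case
    proof (cases "\<exists>D'\<subset>D. dependent_wrt \<B> D'")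
      case True
      then obtain D' where "D' \<subset> D" "dependent_wrt \<B> D'"
        by blast
      then show ?thesis
        using psubset.IH[of D'] psubset.prems by (meson psubset_imp_subset subset_trans)
    next
      case False
      then have "D \<in> circuits E \<B>"
        using psubset.prems by (simp add: circuits_def)
      then show ?thesis
        by blast
    qed
  qed
  then show ?thesis
    using assms that by blast
qed


section \<open>Alternating functions and signed minors\<close>

text \<open>Over a field these are the coefficients of Cramer's rule, a linear dependence among the
  entries of a tuple of length \<open>r + 1\<close>. Indexing by elements rather than positions lets
  terms be reordered and dropped.\<close>

definition signed_minor :: "('a list \<Rightarrow> 'f::hyperfield) \<Rightarrow> 'a list \<Rightarrow> 'a \<Rightarrow> 'f" where
  "signed_minor \<phi> w u =
     (if u \<in> set w then (- 1) ^ length (takeWhile (\<lambda>x. x \<noteq> u) w) * \<phi> (remove1 u w) else 0)"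

lemma signed_minor_append:
  assumes "distinct (us @ p # vs)"
  shows "signed_minor \<phi> (us @ p # vs) p = (- 1) ^ length us * \<phi> (us @ vs)"
proof -
  have "takeWhile (\<lambda>x. x \<noteq> p) (us @ p # vs) = us"
    using assms by (subst takeWhile_append2) auto
  moreover have "remove1 p (us @ p # vs) = us @ vs"
    using assms by (simp add: remove1_append)
  ultimately show ?thesis
    by (simp add: signed_minor_def)
qed

text \<open>Positions count from 1 in \<open>gp_relation\<close> and from 0 in
  \<open>signed_minor\<close>; the resulting common factor -1 does not affect whether zero lies in
  the hypersum.\<close>

lemma gp_relation_iff_signed_minor:
  fixes \<phi> :: "'a list \<Rightarrow> 'f::hyperfield"
  assumes "distinct w" "length w = r + 1"
  shows "gp_relation r \<phi> w ys \<longleftrightarrow> 0 \<in> hsum (map (\<lambda>u. signed_minor \<phi> w u * \<phi> (u # ys)) w)"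
proof -
  have "map (\<lambda>k. (- 1) ^ k * \<phi> (take (k - 1) w @ drop k w) * \<phi> (w ! (k - 1) # ys)) [1..<r + 2] =
      map ((*) (- 1)) (map (\<lambda>u. signed_minor \<phi> w u * \<phi> (u # ys)) w)" (is "?l = ?r")
  proof (rule nth_equalityI)
    fix i
    assume "i < length ?l"
    then have i: "i < length w"
      using assms by (simp del: upt_Suc)
    then have w: "w = take i w @ w ! i # drop (Suc i) w"
      by (simp add: id_take_nth_drop)
    then have "signed_minor \<phi> w (w ! i) = (- 1) ^ i * \<phi> (take i w @ drop (Suc i) w)"
      using signed_minor_append[of "take i w" "w ! i" "drop (Suc i) w"] assms i by simp
    then show "?l ! i = ?r ! i"
      using i assms by (simp add: mult.assoc del: upt_Suc)
  qed (use assms in simp)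
  moreover have "(- 1 :: 'f) \<noteq> 0"
    by (simp add: hyperfield_minus_eq_0_iff)
  ultimately show ?thesis
    unfolding gp_relation_def by (simp only: zero_in_hsum_scale_iff simp_thms)
qed

section \<open>Signs of permutations and the bases of an alternating function\<close>

locale alternating_function =
  fixes E :: "'a set" and r :: nat and \<phi> :: "'a list \<Rightarrow> 'f::hyperfield"
  assumes alternating: "alternating E r \<phi>"
begin

lemma not_distinct_eq_0: "xs \<in> tuples E r \<Longrightarrow> \<not> distinct xs \<Longrightarrow> \<phi> xs = 0"
  using alternating unfolding alternating_def by blast

lemma swap_adjacent:
  assumes "us @ a # b # vs \<in> tuples E r"
  shows "\<phi> (us @ b # a # vs) = - \<phi> (us @ a # b # vs)"
proof -
  let ?xs = "us @ a # b # vs"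
  have "\<phi> (?xs[length us := ?xs ! Suc (length us), Suc (length us) := ?xs ! length us]) =
      (- 1) * \<phi> ?xs"
    using alternating[unfolded alternating_def, rule_format, OF assms, THEN conjunct1, rule_format,
        of "length us" "Suc (length us)"] assms
    by (simp add: tuples_def del: list_update.simps)
  moreover have "?xs[length us := ?xs ! Suc (length us), Suc (length us) := ?xs ! length us] =
      us @ b # a # vs"
    by (simp add: list_update_append nth_append)
  ultimately show ?thesis
    by (simp add: hyperfield_minus_one_mult)
qed

lemma move_to_front:
  assumes "us @ p # ms @ vs \<in> tuples E r"
  shows "\<phi> (us @ ms @ p # vs) = (- 1) ^ length ms * \<phi> (us @ p # ms @ vs)"
  using assms
proof (induction ms arbitrary: us)
  case (Cons b ms)
  then have "(us @ [b]) @ p # ms @ vs \<in> tuples E r"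
    by (auto simp: tuples_def)
  from Cons.IH[OF this] show ?case
    using swap_adjacent[of us p b "ms @ vs"] Cons.prems
    by (simp add: hyperfield_minus_simps)
qed simp

text \<open>The sign \<open>s\<close> is chosen before the prefix \<open>us\<close>, so the same
  sign serves tuples that begin with different elements. The equation \<open>s * s = 1\<close> keeps
  it nonzero.\<close>

lemma permutation_sign:
  assumes "mset xs = mset ys"
  shows "\<exists>s. s * s = 1 \<and>
    (\<forall>us. us @ xs \<in> tuples E r \<longrightarrow> \<phi> (us @ xs) = s * \<phi> (us @ ys))"
  using assms
proof (induction xs arbitrary: ys)
  case Nil
  then show ?case
    by (intro exI[of _ 1]) simp
next
  case (Cons x xs)
  have "x \<in> set ys"
    using Cons.prems by (metis list.set_intros(1) set_mset_mset)
  then obtain y1 y2 where ys: "ys = y1 @ x # y2"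
    using split_list by fastforce
  with Cons.prems have mset_eq: "mset xs = mset (y1 @ y2)"
    by simp
  then obtain s where s: "s * s = 1"
    "\<And>us. us @ xs \<in> tuples E r \<Longrightarrow> \<phi> (us @ xs) = s * \<phi> (us @ y1 @ y2)"
    using Cons.IH by blast
  have "\<phi> (us @ x # xs) = s * (- 1) ^ length y1 * \<phi> (us @ ys)"
    if us: "us @ x # xs \<in> tuples E r" for us
  proof -
    have "set xs = set (y1 @ y2)" "length xs = length (y1 @ y2)"
      using mset_eq by (metis set_mset_mset, metis size_mset)
    then have "us @ x # y1 @ y2 \<in> tuples E r"
      using us by (auto simp: tuples_def)
    then have "\<phi> (us @ ys) = (- 1) ^ length y1 * \<phi> (us @ x # y1 @ y2)"
      using move_to_front ys by blast
    then have "(- 1) ^ length y1 * \<phi> (us @ ys) = \<phi> (us @ x # y1 @ y2)"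
      by (metis hyperfield_minus_one_power_square mult.assoc mult_1)
    then show ?thesis
      using s(2)[of "us @ [x]"] us by (simp add: mult.assoc)
  qed
  moreover have "s * (- 1) ^ length y1 * (s * (- 1) ^ length y1) =
      (s * s) * ((- 1) ^ length y1 * (- 1) ^ length y1)"
    by (simp only: mult_ac)
  then have "s * (- 1) ^ length y1 * (s * (- 1) ^ length y1) = 1"
    by (simp add: s(1) hyperfield_minus_one_power_square)
  ultimately show ?case
    by blast
qed

lemma permutation_nonzero:
  assumes "xs \<in> tuples E r" "\<phi> ys \<noteq> 0" "mset xs = mset ys"
  shows "\<phi> xs \<noteq> 0"
proof -
  obtain s where "s * s = 1" "\<phi> xs = s * \<phi> ys"
    using permutation_sign[OF assms(3)] assms(1) by (metis append_Nil)
  then show ?thesis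
    using assms(2) by (metis hyperfield_mult_eq_0_iff zero_neq_one)
qed

text \<open>A permutation multiplies the value by a nonzero sign, so whether \<phi> vanishes on a
  distinct tuple depends only on its set of entries.\<close>

lemma gp_basis_iff:
  assumes "xs \<in> tuples E r"
  shows "\<phi> xs \<noteq> 0 \<longleftrightarrow> distinct xs \<and> set xs \<in> gp_bases E r \<phi>"
proof
  assume "\<phi> xs \<noteq> 0"
  then show "distinct xs \<and> set xs \<in> gp_bases E r \<phi>"
    using assms not_distinct_eq_0 by (auto simp: gp_bases_def)
next
  assume "distinct xs \<and> set xs \<in> gp_bases E r \<phi>"
  then obtain ys where "distinct xs" "set xs = set ys" "ys \<in> tuples E r" "\<phi> ys \<noteq> 0"
    by (auto simp: gp_bases_def)
  then show "\<phi> xs \<noteq> 0"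
    using permutation_nonzero[OF assms] not_distinct_eq_0 set_eq_iff_mset_eq_distinct by blast
qed

lemma gp_basis_card:
  assumes "B \<in> gp_bases E r \<phi>"
  shows "B \<subseteq> E" "card B = r"
  using assms not_distinct_eq_0 distinct_card by (fastforce simp: gp_bases_def tuples_def)+

text \<open>Moving \<open>p\<close> and \<open>q\<close> to the front takes \<open>length us\<close> and \<open>length us + length ms\<close> swaps; with
  the signs of the two minors only \<open>- 1\<close> remains. The identity is symmetric in \<open>p\<close> and \<open>q\<close>.\<close>

lemma signed_minor_pair:
  assumes "distinct w" "length w = r + 1" "set w \<subseteq> E" "mset w = {#p, q#} + mset v"
  shows "signed_minor \<phi> w p * \<phi> (p # v) = - (signed_minor \<phi> w q * \<phi> (q # v))"
proof -
  have split: "signed_minor \<phi> w p * \<phi> (p # v) = - (signed_minor \<phi> w q * \<phi> (q # v))"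
    if w: "w = us @ p # ms @ q # vs" and v: "mset v = mset (us @ ms @ vs)" for us ms vs p q
  proof -
    let ?v = "us @ ms @ vs"
    have minor_p: "signed_minor \<phi> w p = (- 1) ^ length us * \<phi> (us @ ms @ q # vs)"
      using assms(1) w signed_minor_append[of us p "ms @ q # vs" \<phi>] by simp
    have "distinct ((us @ p # ms) @ q # vs)"
      using assms w by simp
    then have minor_q: "signed_minor \<phi> w q =
        (- 1) ^ (length us + Suc (length ms)) * \<phi> (us @ p # ms @ vs)"
      using w signed_minor_append[of "us @ p # ms" q vs \<phi>] by simp
    have tup: "[] @ q # (us @ ms) @ vs \<in> tuples E r" "[] @ p # us @ ms @ vs \<in> tuples E r"
      using assms w by (auto simp: tuples_def)
    have q: "\<phi> (us @ ms @ q # vs) = (- 1) ^ (length us + length ms) * \<phi> (q # ?v)"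
      using move_to_front[OF tup(1)] by simp
    have p: "\<phi> (us @ p # ms @ vs) = (- 1) ^ length us * \<phi> (p # ?v)"
      using move_to_front[OF tup(2)] by simp
    obtain s where s: "\<And>a. [a] @ ?v \<in> tuples E r \<Longrightarrow> \<phi> ([a] @ ?v) = s * \<phi> ([a] @ v)"
      using permutation_sign[OF v[symmetric]] by blast
    have vq: "\<phi> (q # ?v) = s * \<phi> (q # v)" and vp: "\<phi> (p # ?v) = s * \<phi> (p # v)"
      using s(1)[of q] s(1)[of p] tup by simp_all
    show ?thesis
      unfolding minor_p minor_q p q vq vp
      by (simp add: power_add hyperfield_minus_simps mult_ac)
  qed
  have "p \<in># mset w" "q \<in># mset w"
    using assms(4) by simp_all
  then have mem: "p \<in> set w" "q \<in> set w"
    by simp_all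
  have neq: "p \<noteq> q"
  proof
    assume "p = q"
    then have "count (mset w) p \<ge> 2"
      using assms(4) by simp
    then show False
      using assms(1) mem(1) distinct_count_atmost_1[of w] by fastforce
  qed
  obtain us vs where w: "w = us @ p # vs"
    using mem split_list by fastforce
  then consider "q \<in> set vs" | "q \<in> set us"
    using mem neq by auto
  then show ?thesis
  proof cases
    case 1
    then obtain ms vs' where "vs = ms @ q # vs'"
      using split_list by fastforce
    with w show ?thesis
      using split[of us p ms q vs'] assms(4) by simp
  next
    case 2
    then obtain us' ms where "us = us' @ q # ms"
      using split_list by fastforce
    with w have "signed_minor \<phi> w q * \<phi> (q # v) = - (signed_minor \<phi> w p * \<phi> (p # v))"
      using split[of us' q ms p vs] assms(4) by simp
    then show ?thesis
      by (simp add: hyperfield_minus_simps)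
  qed
qed

end


section \<open>Vectors of a weak Grassmann--Pluecker function\<close>

lemma card_set_diff_pair:
  assumes "distinct w" "distinct ys" "length w = length ys + 2" "card (set w - set ys) = 2"
  obtains p q where "p \<noteq> q" "set w - set ys = {p, q}" "mset w = {#p, q#} + mset ys"
proof -
  obtain p q where pq: "p \<noteq> q" "set w - set ys = {p, q}"
    using assms(4) by (auto simp: card_2_iff)
  have "card (set w) = card (set w - set ys) + card (set w \<inter> set ys)"
    by (simp add: card_Diff_subset_Int card_mono)
  then have "card (set w \<inter> set ys) = card (set ys)"
    using assms by (simp add: distinct_card)
  then have "set w \<inter> set ys = set ys"
    by (intro card_subset_eq) auto
  then have "set w = set (p # q # ys)"
    using pq by auto
  moreover have "distinct (p # q # ys)"
    using pq assms by auto
  ultimately have "mset w = mset (p # q # ys)"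
    using assms(1) set_eq_iff_mset_eq_distinct by blast
  then show ?thesis
    using that pq by simp
qed

section \<open>Relations and ratios along a circuit\<close>

locale weak_gp_function =
  fixes E :: "'a set" and r :: nat and \<phi> :: "'a list \<Rightarrow> 'f::hyperfield"
  assumes finite_E: "finite E"
    and weak_gp: "weak_grassmann_pluecker E r \<phi>"
begin

sublocale alternating_function E r \<phi>
  using weak_gp by unfold_locales (simp add: weak_grassmann_pluecker_def)

abbreviation "\<B> \<equiv> gp_bases E r \<phi>"
abbreviation "\<C> \<equiv> gp_circuits E r \<phi>"

lemma matroid: "matroid_bases E r \<B>"
  using weak_gp by (simp add: weak_grassmann_pluecker_def)

lemma basis_list:
  assumes "distinct xs" "set xs \<in> \<B>"
  shows "xs \<in> tuples E r" "\<phi> xs \<noteq> 0"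
proof -
  show "xs \<in> tuples E r"
    using assms gp_basis_card[of "set xs"] by (auto simp: tuples_def distinct_card)
  then show "\<phi> xs \<noteq> 0"
    using assms gp_basis_iff by blast
qed

lemma vanishing_on_circuit:
  assumes "C \<in> circuits E \<B>" "C \<subseteq> set xs" "xs \<in> tuples E r"
  shows "\<phi> xs = 0"
  using assms circuit_not_subset_basis gp_basis_iff by blast

text \<open>The lengths \<open>r + 1\<close> and \<open>r - 1\<close> force at least two entries of
  \<open>w\<close> outside \<open>ys\<close>. Three is the axiom. If there are two, the terms at
  entries of \<open>ys\<close> vanish by repetition and the other two are opposite by
  \<open>signed_minor_pair\<close>.\<close>

lemma small_relation:
  assumes "distinct w" "length w = r + 1" "set w \<subseteq> E"
    and "distinct ys" "length ys + 1 = r" "set ys \<subseteq> E" "card (set w - set ys) \<le> 3"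
  shows "gp_relation r \<phi> w ys"
proof -
  have "card (set w) - card (set ys) \<le> card (set w - set ys)"
    by (simp add: diff_card_le_card_Diff)
  then have "2 \<le> card (set w - set ys)"
    using assms by (simp add: distinct_card)
  then consider "card (set w - set ys) = 3" | "card (set w - set ys) = 2"
    using assms(7) by linarith
  then show ?thesis
  proof cases
    case 1
    then show ?thesis
      using weak_gp assms unfolding weak_grassmann_pluecker_def by simp
  next
    case 2
    have "length w = length ys + 2"
      using assms by simp
    then obtain p q where pq: "p \<noteq> q" "set w - set ys = {p, q}" "mset w = {#p, q#} + mset ys"
      using card_set_diff_pair[OF assms(1,4) _ 2] by blast
    let ?g = "\<lambda>u. signed_minor \<phi> w u * \<phi> (u # ys)"
    have "?g u = 0" if "u \<in> set ys" for u
      using that assms not_distinct_eq_0[of "u # ys"] by (auto simp: tuples_def)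
    then have "{u \<in> set w. ?g u \<noteq> 0} = {u \<in> set [p, q]. ?g u \<noteq> 0}"
      using pq(2) by auto
    then have "hsum (map ?g w) = hsum (map ?g [p, q])"
      using hsum_map_cong_nonzero[of w "[p, q]" ?g] assms(1) pq(1) by simp
    also have "\<dots> = ?g p \<boxplus> ?g q"
      by (simp only: list.map hsum_pair)
    also have "?g q = - ?g p"
      using signed_minor_pair[OF assms(1-3) pq(3)] by (simp add: hyperfield_minus_minus)
    finally show ?thesis
      using assms by (simp add: gp_relation_iff_signed_minor zero_in_hadd_uminus)
  qed
qed

text \<open>For \<open>b \<noteq> c\<close>, consider the relation for \<open>e # f # b # v\<close>
  and \<open>c # v\<close>. Its terms at \<open>v\<close> vanish by repetition, and the one at
  \<open>b\<close> vanishes since \<open>e # f # v\<close> contains \<open>C\<close>. The terms at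
  \<open>e\<close> and \<open>f\<close> remain.\<close>

lemma exchange_one:
  assumes C: "C \<in> circuits E \<B>" "e \<in> C" "f \<in> C" "e \<noteq> f"
    and b: "f # b # v \<in> tuples E r" "\<phi> (f # b # v) \<noteq> 0" "C - {e} \<subseteq> set (f # b # v)"
    and c: "f # c # v \<in> tuples E r" "\<phi> (f # c # v) \<noteq> 0" "C - {e} \<subseteq> set (f # c # v)"
  shows "\<phi> (e # b # v) * \<phi> (f # c # v) = \<phi> (f # b # v) * \<phi> (e # c # v)"
proof (cases "b = c")
  case True
  then show ?thesis
    by (simp add: mult.commute)
next
  case False
  let ?w = "[e, f] @ b # v" and ?ys = "c # v"
  have db: "distinct (f # b # v)" and dc: "distinct (f # c # v)"
    using b c gp_basis_iff by blast+
  have eE: "e \<in> E"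
    using C by (auto simp: circuits_def)
  have "e \<notin> set (f # b # v)" "e \<notin> set (f # c # v)"
    using vanishing_on_circuit[OF C(1) _ b(1)] vanishing_on_circuit[OF C(1) _ c(1)] b(2,3) c(2,3)
    by blast+
  then have dw: "distinct ?w"
    using db by auto
  have len: "length ?w = r + 1" and wE: "set ?w \<subseteq> E"
    using b(1) eE by (auto simp: tuples_def)
  have lys: "length ?ys + 1 = r" and ysE: "set ?ys \<subseteq> E"
    using c(1) by (auto simp: tuples_def)
  have "card (set ?w - set ?ys) \<le> card (set [e, f, b])"
    by (intro card_mono) auto
  also have "\<dots> \<le> 3"
    using card_length[of "[e, f, b]"] by simp
  finally have "gp_relation r \<phi> ?w ?ys"
    using small_relation[OF dw len wE _ lys ysE] dc by simp
  then have rel: "0 \<in> hsum (map (\<lambda>u. signed_minor \<phi> ?w u * \<phi> (u # ?ys)) ?w)"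
    using gp_relation_iff_signed_minor[OF dw len] by blast
  let ?g = "\<lambda>u. signed_minor \<phi> ?w u * \<phi> (u # ?ys)"
  have "?g u = 0" if "u \<in> set v" for u
    using that lys ysE not_distinct_eq_0[of "u # ?ys"] by (auto simp: tuples_def hyperfield_mult_eq_0_iff)
  moreover have "?g b = 0"
  proof -
    have "C \<subseteq> set (e # f # v)"
      using b(3) c(3) False by auto
    then have "\<phi> (e # f # v) = 0"
      using vanishing_on_circuit[OF C(1)] b(1) eE by (auto simp: tuples_def)
    then show ?thesis
      using signed_minor_append[OF dw, of \<phi>] by simp
  qed
  ultimately have "{u \<in> set ?w. ?g u \<noteq> 0} = {u \<in> set [e, f]. ?g u \<noteq> 0}"
    by auto
  then have "hsum (map ?g ?w) = hsum (map ?g [e, f])"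
    using hsum_map_cong_nonzero[of ?w "[e, f]" ?g] dw C(4) by simp
  also have "\<dots> = ?g e \<boxplus> ?g f"
    by (simp only: list.map hsum_pair)
  finally have "?g f = - ?g e"
    using rel by (simp add: zero_in_hadd_iff)
  moreover have "signed_minor \<phi> ?w e = \<phi> (f # b # v)"
    using signed_minor_append[of "[]" e "f # b # v" \<phi>] dw by simp
  moreover have "signed_minor \<phi> ?w f = - \<phi> (e # b # v)"
    using signed_minor_append[of "[e]" f "b # v" \<phi>] dw by (simp add: hyperfield_minus_one_mult)
  ultimately have "- (\<phi> (e # b # v) * \<phi> (f # c # v)) = - (\<phi> (f # b # v) * \<phi> (e # c # v))"
    by (simp add: hyperfield_minus_mult_left)
  then show ?thesis
    by (metis hyperfield_minus_minus)
qed

text \<open>Basis exchange connects the two bases by steps that change a single element.\<close>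

lemma exchange:
  assumes C: "C \<in> circuits E \<B>" "e \<in> C" "f \<in> C" "e \<noteq> f"
    and xs: "f # xs \<in> tuples E r" "\<phi> (f # xs) \<noteq> 0" "C - {e} \<subseteq> set (f # xs)"
    and ys: "f # ys \<in> tuples E r" "\<phi> (f # ys) \<noteq> 0" "C - {e} \<subseteq> set (f # ys)"
  shows "\<phi> (e # xs) * \<phi> (f # ys) = \<phi> (f # xs) * \<phi> (e # ys)"
  using xs
proof (induction "card (set xs - set ys)" arbitrary: xs rule: less_induct)
  case less
  have eE: "e \<in> E"
    using C by (auto simp: circuits_def)
  have dx: "distinct (f # xs)" "set (f # xs) \<in> \<B>" and dy: "distinct (f # ys)" "set (f # ys) \<in> \<B>"
    using less.prems ys gp_basis_iff by blast+
  \<comment> \<open>One sign serves both prefixes \<open>e\<close> and \<open>f\<close> and cancels.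
    This settles the case of equal sets and later brings \<open>b\<close> to the front of
    \<open>xs\<close>.\<close>
  have perm: "\<phi> (e # xs) * \<phi> (f # zs) = \<phi> (f # xs) * \<phi> (e # zs)"
    if "mset xs = mset zs" for zs
  proof -
    obtain s where "\<And>us. us @ xs \<in> tuples E r \<Longrightarrow> \<phi> (us @ xs) = s * \<phi> (us @ zs)"
      using permutation_sign[OF \<open>mset xs = mset zs\<close>] by blast
    from this[of "[e]"] this[of "[f]"] have "\<phi> (e # xs) = s * \<phi> (e # zs)"
      and "\<phi> (f # xs) = s * \<phi> (f # zs)"
      using less.prems(1) eE by (simp_all add: tuples_def)
    then show ?thesis
      by (simp only: mult_ac)
  qed
  show ?case
  proof (cases "set xs \<subseteq> set ys")
    case True
    have "card (set xs) = card (set ys)"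
      using dx dy less.prems(1) ys(1) by (simp add: distinct_card tuples_def)
    then have "set xs = set ys"
      using True by (simp add: card_subset_eq)
    then show ?thesis
      using perm dx dy set_eq_iff_mset_eq_distinct[of xs ys] by auto
  next
    case False
    then obtain b where b: "b \<in> set xs" "b \<notin> set ys"
      by blast
    have "b \<in> set (f # xs) - set (f # ys)"
      using b dx by auto
    then obtain c where c: "c \<in> set (f # ys) - set (f # xs)"
      "insert c (set (f # xs) - {b}) \<in> \<B>"
      using matroid_basis_exchange[OF matroid dx(2) dy(2)] by blast
    define v where "v = remove1 b xs"
    have v: "mset xs = mset (b # v)"
      using b by (simp add: v_def)
    then have set_xs: "set xs = insert b (set v)"
      by (metis list.simps(15) mset_eq_setD)
    have "distinct (b # v)"
      using v dx by (metis distinct.simps(2) mset_eq_imp_distinct_iff)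
    then have bv: "distinct (f # b # v)"
      using dx(1) set_xs by simp
    have dcv: "distinct (f # c # v)"
      using bv c(1) set_xs by auto
    have "insert c (set (f # xs) - {b}) = set (f # c # v)"
      using bv c(1) set_xs by auto
    then have fcv: "f # c # v \<in> tuples E r" "\<phi> (f # c # v) \<noteq> 0"
      using basis_list[OF dcv] c(2) by simp_all
    have "set (f # b # v) = set (f # xs)"
      using set_xs by simp
    then have fbv: "f # b # v \<in> tuples E r" "\<phi> (f # b # v) \<noteq> 0" "C - {e} \<subseteq> set (f # b # v)"
      using basis_list[OF bv] dx(2) less.prems(3) by simp_all
    have "e \<notin> set (f # xs)"
      using circuit_not_subset_basis[OF C(1) dx(2)] less.prems(3) by blast
    then have "b \<noteq> e"
      using b(1) by auto
    \<comment> \<open>The exchange must keep \<open>C - {e}\<close> inside the tuple;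
      \<open>b\<close> is missing from the basis of \<open>f # ys\<close>, which contains
      \<open>C - {e}\<close>.\<close>
    then have "b \<notin> C"
      using ys(3) \<open>b \<in> set (f # xs) - set (f # ys)\<close> by blast
    then have Cv: "C - {e} \<subseteq> set (f # c # v)"
      using less.prems(3) set_xs by auto
    have step: "\<phi> (e # b # v) * \<phi> (f # c # v) = \<phi> (f # b # v) * \<phi> (e # c # v)"
      using exchange_one[OF C fbv fcv Cv] .
    have "c \<in> set ys"
      using c(1) by auto
    then have "set (c # v) - set ys \<subseteq> set xs - set ys"
      unfolding set_xs by auto
    moreover have "b \<notin> set (c # v)"
      using bv b(1) c(1) by auto
    ultimately have "set (c # v) - set ys \<subset> set xs - set ys"
      using b by blast
    then have "card (set (c # v) - set ys) < card (set xs - set ys)"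
      by (intro psubset_card_mono) simp_all
    then have IH: "\<phi> (e # c # v) * \<phi> (f # ys) = \<phi> (f # c # v) * \<phi> (e # ys)"
      by (rule less.hyps[OF _ fcv Cv])
    have xs_bv: "\<phi> (e # xs) * \<phi> (f # b # v) = \<phi> (f # xs) * \<phi> (e # b # v)"
      using perm v by blast
    \<comment> \<open>The single step and the induction hypothesis are composed after multiplying by
      a nonzero factor, which is cancelled at the end.\<close>
    have "(\<phi> (f # b # v) * \<phi> (f # c # v)) * (\<phi> (e # xs) * \<phi> (f # ys)) =
        (\<phi> (e # xs) * \<phi> (f # b # v)) * (\<phi> (f # c # v) * \<phi> (f # ys))"
      by (simp only: mult_ac)
    also have "\<dots> = \<phi> (f # xs) * (\<phi> (e # b # v) * \<phi> (f # c # v)) * \<phi> (f # ys)"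
      by (simp only: xs_bv mult.assoc)
    also have "\<dots> = \<phi> (f # xs) * \<phi> (f # b # v) * (\<phi> (e # c # v) * \<phi> (f # ys))"
      by (simp only: step mult.assoc)
    also have "\<dots> = (\<phi> (f # b # v) * \<phi> (f # c # v)) * (\<phi> (f # xs) * \<phi> (e # ys))"
      by (simp only: IH) (simp only: mult_ac)
    finally show ?thesis
      using fbv(2) fcv(2) by (simp add: hyperfield_mult_cancel_left hyperfield_mult_eq_0_iff)
  qed
qed

text \<open>\<open>C\<close> is the fundamental circuit of \<open>z\<close> over a basis
  \<open>B\<close>; the vector consists of the rescaled signed minors of \<open>z\<close> followed
  by \<open>B\<close>. \<open>signed_minor_pair\<close> yields the ratio condition for one tuple and
  \<open>exchange\<close> carries it over to all others.\<close>

lemma circuit_vector_exists: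
  assumes C: "C \<in> circuits E \<B>" "z \<in> C" and "\<alpha> \<noteq> 0"
  obtains X where "X \<in> \<C>" "supp E X = C" "X z = \<alpha>"
proof -
  have CE: "C \<subseteq> E"
    using C by (auto simp: circuits_def)
  obtain B where B: "B \<in> \<B>" "C - {z} \<subseteq> B"
    using circuit_delete_subset_basis[OF C] .
  have zB: "z \<notin> B"
    using B circuit_not_subset_basis[OF C(1) B(1)] by blast
  have "finite B"
    using gp_basis_card[OF B(1)] finite_E finite_subset by blast
  then obtain w' where w': "set w' = B" "distinct w'"
    using finite_distinct_list by blast
  define w where "w = z # w'"
  have w'_basis: "w' \<in> tuples E r" "\<phi> w' \<noteq> 0"
    using basis_list w' B by auto
  have dw: "distinct w" and len: "length w = r + 1" and wE: "set w \<subseteq> E" and Cw: "C \<subseteq> set w"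
    using w' w'_basis(1) zB C CE B by (auto simp: w_def tuples_def)
  have minor_z: "signed_minor \<phi> w z = \<phi> w'"
    using signed_minor_append[of "[]" z w' \<phi>] dw by (simp add: w_def)
  \<comment> \<open>A basis between \<open>C - {u}\<close> and \<open>set w\<close> cannot contain
    \<open>u\<close>, as it would then contain \<open>C\<close>; its size leaves only
    \<open>set w - {u}\<close>.\<close>
  have delete: "set w - {u} \<in> \<B>" if u: "u \<in> C" for u
  proof -
    obtain A where "A \<in> \<B>" "C - {u} \<subseteq> A"
      using circuit_delete_subset_basis[OF C(1) u] .
    moreover have "B \<subseteq> set w" "C - {u} \<subseteq> set w"
      using w' Cw by (auto simp: w_def)
    ultimately obtain B' where B': "B' \<in> \<B>" "C - {u} \<subseteq> B'" "B' \<subseteq> set w"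
      using matroid_basis_between[OF matroid finite_E _ B(1)] that by blast
    then have "B' \<subseteq> set w - {u}"
      using circuit_not_subset_basis[OF C(1) B'(1)] by blast
    moreover have "card B' = card (set w - {u})"
      using gp_basis_card[OF B'(1)] u Cw dw len by (auto simp: distinct_card)
    ultimately have "B' = set w - {u}"
      by (intro card_subset_eq) auto
    then show ?thesis
      using B' by simp
  qed
  have minor_supp: "signed_minor \<phi> w u \<noteq> 0 \<longleftrightarrow> u \<in> C" for u
  proof (cases "u \<in> set w")
    case True
    then obtain us vs where w: "w = us @ u # vs"
      using split_list by fastforce
    have d: "distinct (us @ vs)" and st: "set (us @ vs) = set w - {u}"
      and tp: "us @ vs \<in> tuples E r"
      using dw len wE by (auto simp: w tuples_def)
    have "signed_minor \<phi> w u \<noteq> 0 \<longleftrightarrow> \<phi> (us @ vs) \<noteq> 0"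
      using signed_minor_append[of us u vs \<phi>] dw w hyperfield_minus_one_power_square[of "length us"]
      by (metis hyperfield_mult_eq_0_iff zero_neq_one)
    also have "\<dots> \<longleftrightarrow> set w - {u} \<in> \<B>"
      using gp_basis_iff[OF tp] d st by simp
    also have "\<dots> \<longleftrightarrow> u \<in> C"
      using delete Cw circuit_not_subset_basis[OF C(1)] by blast
    finally show ?thesis .
  next
    case False
    then show ?thesis
      using Cw by (auto simp: signed_minor_def)
  qed
  \<comment> \<open>The minor at \<open>z\<close> is \<open>\<phi> w'\<close>, so this factor makes
    the value at \<open>z\<close> equal to \<alpha>.\<close>
  define \<beta> where "\<beta> = \<alpha> * inverse (\<phi> w')"
  have \<beta>: "\<beta> * \<phi> w' = \<alpha>"
    using w'_basis(2) by (simp add: \<beta>_def mult.assoc hyperfield_inverse_left)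
  then have \<beta>0: "\<beta> \<noteq> 0"
    using \<open>\<alpha> \<noteq> 0\<close> by auto
  define X where "X = restrict (\<lambda>u. \<beta> * signed_minor \<phi> w u) E"
  have X: "X u = \<beta> * signed_minor \<phi> w u" if "u \<in> E" for u
    using that by (simp add: X_def)
  have "X u \<noteq> 0 \<longleftrightarrow> u \<in> C" if "u \<in> E" for u
    using minor_supp[of u] \<beta>0 X[OF that] by (simp add: hyperfield_mult_eq_0_iff)
  then have supp_X: "supp E X = C"
    using CE by (auto simp: supp_def)
  have "X f / X e = - (\<phi> (e # xs) / \<phi> (f # xs))"
    if ef: "e \<in> E" "f \<in> E" and xs: "f # xs \<in> tuples E r" "set (f # xs) \<in> \<B>" "C - {e} \<subseteq> set (f # xs)"
    for e f xs
  proof -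
    have "\<not> C \<subseteq> set (f # xs)"
      using circuit_not_subset_basis[OF C(1) xs(2)] .
    then have e: "e \<in> C" "e \<notin> set (f # xs)"
      using xs(3) by blast+
    show ?thesis
    proof (cases "f \<in> C")
      case False
      \<comment> \<open>For \<open>f\<close> outside \<open>C\<close>, replacing \<open>f\<close> by
        \<open>e\<close> completes \<open>C\<close> inside the tuple, so both sides of the ratio
        condition are zero.\<close>
      then have "X f = 0"
        using minor_supp[of f] ef(2) by (simp add: X)
      moreover have "\<phi> (e # xs) = 0"
      proof (intro vanishing_on_circuit[OF C(1)])
        show "C \<subseteq> set (e # xs)"
          using xs(3) False by auto
        show "e # xs \<in> tuples E r"
          using xs(1) ef(1) by (simp add: tuples_def)
      qed
      ultimately show ?thesis
        by (simp add: hyperfield_zero_divide hyperfield_minus_zero)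
    next
      case True
      \<comment> \<open>The entries of \<open>f # v\<close> are those of \<open>w\<close> without
        \<open>e\<close>. This is the reference tuple, where the ratio is known from
        \<open>signed_minor_pair\<close>.\<close>
      define v where "v = remove1 f (remove1 e w)"
      have fe: "f \<noteq> e"
        using e by auto
      have "e \<in> set w" "f \<in> set (remove1 e w)"
        using True e(1) Cw fe by auto
      moreover have "mset ys = add_mset x (mset (remove1 x ys))"
        if "x \<in> set ys" for x and ys :: "'a list"
        using that by simp
      ultimately have "mset w = add_mset e (add_mset f (mset v))"
        unfolding v_def by metis
      then have v: "mset w = {#f, e#} + mset v"
        by (simp add: add_mset_commute)
      have "distinct (remove1 e w)" "set (remove1 e w) = set w - {e}"
        using dw by auto
      then have d: "distinct (f # v)" and s: "set (f # v) = set w - {e}"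
        using True Cw fe by (auto simp: v_def)
      have fv: "f # v \<in> tuples E r" "\<phi> (f # v) \<noteq> 0"
        using basis_list[OF d] s delete[OF e(1)] by simp_all
      have Cv: "C - {e} \<subseteq> set (f # v)"
        using s Cw by auto
      have "card (set (f # xs)) = length (f # xs)"
        using gp_basis_card(2)[OF xs(2)] xs(1) by (simp only: tuples_def mem_Collect_eq)
      then have dxs: "distinct (f # xs)"
        by (rule card_distinct)
      then have fxs: "\<phi> (f # xs) \<noteq> 0"
        using basis_list xs by blast
      have swap: "\<phi> (e # xs) * \<phi> (f # v) = \<phi> (f # xs) * \<phi> (e # v)"
        using exchange[OF C(1) e(1) True fe[symmetric] xs(1) fxs xs(3) fv Cv] .
      have pair: "X f * \<phi> (f # v) = - (X e * \<phi> (e # v))"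
        using signed_minor_pair[OF dw len wE v] ef
        by (simp add: X mult.assoc hyperfield_minus_mult_right)
      have "\<phi> (f # v) * (X f * \<phi> (f # xs)) = (X f * \<phi> (f # v)) * \<phi> (f # xs)"
        by (simp only: mult_ac)
      also have "\<dots> = - (X e * (\<phi> (f # xs) * \<phi> (e # v)))"
        by (simp only: pair hyperfield_minus_simps) (simp only: mult_ac)
      also have "\<dots> = \<phi> (f # v) * - (X e * \<phi> (e # xs))"
        by (simp only: swap[symmetric] hyperfield_minus_simps) (simp only: mult_ac)
      finally have "X f * \<phi> (f # xs) = - (X e * \<phi> (e # xs))"
        using fv(2) hyperfield_mult_cancel_left by blast
      moreover have "X e \<noteq> 0"
        using e(1) supp_X by (auto simp: supp_def)
      ultimately show ?thesis
        using fxs by (simp add: hyperfield_divide_eq_minus_divide_iff)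
    qed
  qed
  moreover have "X \<in> E \<rightarrow>\<^sub>E UNIV"
    by (simp add: X_def)
  ultimately have "X \<in> \<C>"
    using C(1) unfolding gp_circuits_def mem_Collect_eq supp_X by blast
  moreover have "X z = \<alpha>"
    using \<beta> minor_z C CE by (auto simp: X)
  ultimately show ?thesis
    using that supp_X by blast
qed

lemma circuit_vector_supp: "X \<in> \<C> \<Longrightarrow> supp E X \<in> circuits E \<B>"
  by (simp add: gp_circuits_def)

text \<open>The ratio condition without denominators; it covers \<open>f\<close> outside the support
  as well.\<close>

lemma circuit_vector_ratio:
  assumes "X \<in> \<C>" "e \<in> supp E X" "f \<in> E" "distinct (f # xs)" "set (f # xs) \<in> \<B>"
    and "supp E X - {e} \<subseteq> set (f # xs)"
  shows "X f * \<phi> (f # xs) = - (X e * \<phi> (e # xs))"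
proof -
  have "X e \<noteq> 0" "e \<in> E"
    using assms(2) by (auto simp: supp_def)
  moreover have "f # xs \<in> tuples E r" "\<phi> (f # xs) \<noteq> 0"
    using basis_list assms by blast+
  moreover have "X f / X e = - (\<phi> (e # xs) / \<phi> (f # xs))"
    using assms calculation unfolding gp_circuits_def by blast
  ultimately show ?thesis
    by (simp add: hyperfield_divide_eq_minus_divide_iff)
qed

text \<open>On a basis completed by \<open>z\<close>, the vector \<open>X\<close> is proportional to the signed minors, so a
  Grassmann--Pluecker relation says that \<open>X\<close> is orthogonal to the function \<open>\<phi> (\<cdot> # ys)\<close>.\<close>

lemma circuit_vector_orthogonal:
  assumes X: "X \<in> \<C>" "z \<in> supp E X"
    and w: "distinct w" "set w \<in> \<B>" "supp E X - {z} \<subseteq> set w"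
    and rel: "gp_relation r \<phi> (z # w) ys"
  shows "0 \<in> hsum (map (\<lambda>u. X u * \<phi> (u # ys)) (z # w))"
proof -
  have w_basis: "w \<in> tuples E r" "\<phi> w \<noteq> 0"
    using basis_list w by auto
  have z: "z \<notin> set w" "z \<in> E" "X z \<noteq> 0"
    using circuit_not_subset_basis[OF circuit_vector_supp[OF X(1)] w(2)] X(2) w(3)
    by (auto simp: supp_def)
  have dw: "distinct (z # w)" and len: "length (z # w) = r + 1" and wE: "set (z # w) \<subseteq> E"
    using w z w_basis(1) by (auto simp: tuples_def)
  have minor_z: "signed_minor \<phi> (z # w) z = \<phi> w"
    using signed_minor_append[of "[]" z w \<phi>] dw by simp
  \<comment> \<open>By \<open>circuit_vector_ratio\<close> and \<open>signed_minor_pair\<close>, the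
    value at \<open>u\<close> is determined by the value at \<open>z\<close> in the same way for
    \<open>X\<close> and for the minors.\<close>
  have proportional: "\<phi> w * X u = X z * signed_minor \<phi> (z # w) u" if u: "u \<in> set (z # w)" for u
  proof (cases "u = z")
    case True
    then show ?thesis
      by (simp add: minor_z mult.commute)
  next
    case False
    then have uw: "u \<in> set w"
      using u by simp
    define v where "v = remove1 u w"
    have v: "mset (z # w) = {#u, z#} + mset v" and d: "distinct (u # v)" and s: "set (u # v) = set w"
      using uw w(1) by (auto simp: v_def)
    have uv: "\<phi> (u # v) \<noteq> 0"
      using basis_list[OF d] s w(2) by simp
    have ratio: "X u * \<phi> (u # v) = - (X z * \<phi> (z # v))"
      using circuit_vector_ratio[OF X _ d] s w wE u by auto
    have minors: "signed_minor \<phi> (z # w) u * \<phi> (u # v) = - (\<phi> w * \<phi> (z # v))"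
      using signed_minor_pair[OF dw len wE v] minor_z by simp
    have "\<phi> (u # v) * (\<phi> w * X u) = \<phi> w * (X u * \<phi> (u # v))"
      by (simp only: mult_ac)
    also have "\<dots> = X z * - (\<phi> w * \<phi> (z # v))"
      by (simp only: ratio hyperfield_minus_simps) (simp only: mult_ac)
    also have "\<dots> = \<phi> (u # v) * (X z * signed_minor \<phi> (z # w) u)"
      by (simp only: minors[symmetric]) (simp only: mult_ac)
    finally show ?thesis
      using hyperfield_mult_cancel_left[OF uv] by blast
  qed
  have "map ((*) (\<phi> w)) (map (\<lambda>u. X u * \<phi> (u # ys)) (z # w)) =
      map ((*) (X z)) (map (\<lambda>u. signed_minor \<phi> (z # w) u * \<phi> (u # ys)) (z # w))"
    using proportional by (simp add: mult.assoc[symmetric])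
  then have "0 \<in> hsum (map ((*) (\<phi> w)) (map (\<lambda>u. X u * \<phi> (u # ys)) (z # w)))"
    using rel unfolding gp_relation_iff_signed_minor[OF dw len]
    by (simp only: zero_in_hsum_scale_iff[OF z(3)])
  then show ?thesis
    by (simp only: zero_in_hsum_scale_iff[OF w_basis(2)])
qed

end


section \<open>Modular elimination\<close>

text \<open>\<open>Max\<close> is an upper bound only for a finite set. The members of a strict
  chain are distinct subsets of \<open>E\<close>, so lengths are bounded by
  \<open>card (Pow E)\<close>.\<close>

lemma length_le_height:
  assumes "finite E" "\<L> \<subseteq> Pow E" "set cs \<subseteq> \<L>" "sorted_wrt (\<subset>) (cs @ [u])"
  shows "length cs \<le> height \<L> u"
proof -
  have chain_distinct: "distinct ds" if "sorted_wrt (\<subset>) ds" for ds :: "'a set list"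
    using that by (induction ds) (simp, fastforce)
  have "length ds \<le> card (Pow E)" if ds: "set ds \<subseteq> \<L>" "sorted_wrt (\<subset>) (ds @ [u])" for ds
  proof -
    have "distinct ds"
      using chain_distinct[of "ds @ [u]"] ds by simp
    then have "length ds = card (set ds)"
      by (simp add: distinct_card)
    also have "\<dots> \<le> card (Pow E)"
      using assms(1) subset_trans[OF ds(1) assms(2)] by (simp add: card_mono)
    finally show ?thesis .
  qed
  then have "{length cs | cs. set cs \<subseteq> \<L> \<and> sorted_wrt (\<subset>) (cs @ [u])} \<subseteq> {..card (Pow E)}"
    by blast
  then have "finite {length cs | cs. set cs \<subseteq> \<L> \<and> sorted_wrt (\<subset>) (cs @ [u])}"
    by (rule finite_subset[OF _ finite_atMost])
  then show ?thesis
    unfolding height_def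
  proof (rule Max_ge)
    show "length cs \<in> {length cs | cs. set cs \<subseteq> \<L> \<and> sorted_wrt (\<subset>) (cs @ [u])}"
      using assms(3,4) by blast
  qed
qed

context weak_gp_function
begin

text \<open>If the set below contained a circuit \<open>D\<close>, then adding the supports of the vectors one at a
  time to \<open>D\<close> would give a chain that is too long for a modular family.\<close>

lemma modular_family_independent:
  assumes modular: "modular_family E \<C> (Xs @ [X])"
    and len: "length es = length Xs"
    and es: "\<And>i j. i < length Xs \<Longrightarrow> j < length Xs \<Longrightarrow> es ! i \<in> supp E (Xs ! j) \<longleftrightarrow> i = j"
    and z: "z \<in> supp E X" "\<And>Y. Y \<in> set Xs \<Longrightarrow> z \<notin> supp E Y"
  shows "\<exists>B\<in>\<B>. (\<Union>Y\<in>set (Xs @ [X]). supp E Y) - insert z (set es) \<subseteq> B"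
proof (rule ccontr)
  let ?U = "\<Union>Y\<in>set (Xs @ [X]). supp E Y" and ?k = "length Xs" and ?L = "support_unions E \<C>"
  let ?B = "?U - insert z (set es)"
  assume "\<not> (\<exists>B\<in>\<B>. ?B \<subseteq> B)"
  then have "dependent_wrt \<B> ?B"
    by (simp add: dependent_wrt_def)
  moreover have "?B \<subseteq> E"
    by (auto simp: supp_def)
  ultimately obtain D where D: "D \<in> circuits E \<B>" "D \<subseteq> ?B"
    using dependent_contains_circuit[OF finite_E] by blast
  obtain B where B: "B \<in> \<B>"
    using matroid unfolding matroid_bases_def by blast
  then have "D \<noteq> {}"
    using circuit_not_subset_basis[OF D(1)] by blast
  then obtain d where "d \<in> D"
    by blast
  \<comment> \<open>Realizing \<open>D\<close> as the support of a vector puts it into the lattice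
    of unions.\<close>
  then obtain Y where Y: "Y \<in> \<C>" "supp E Y = D"
    using circuit_vector_exists[OF D(1) _ one_neq_zero] by metis
  have XsC: "set (Xs @ [X]) \<subseteq> \<C>" and height: "height ?L ?U = Suc ?k"
    using modular by (simp_all add: modular_family_def)
  define T where "T i = D \<union> (\<Union>j<i. supp E (Xs ! j))" for i
  have T_L: "T i \<in> ?L" if "i \<le> ?k" for i
  proof -
    have "T i = \<Union> (supp E ` insert Y ((!) Xs ` {..<i}))"
      by (simp add: T_def Y(2))
    moreover have "Xs ! j \<in> \<C>" if "j < i" for j
      using XsC nth_mem[of j Xs] that \<open>i \<le> ?k\<close> by auto
    then have "insert Y ((!) Xs ` {..<i}) \<subseteq> \<C>"
      using Y(1) by blast
    then have "supp E ` insert Y ((!) Xs ` {..<i}) \<subseteq> supp E ` \<C>"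
      by (rule image_mono)
    ultimately show ?thesis
      unfolding support_unions_def by blast
  qed
  have T_mono: "T i \<subseteq> T j" if "i \<le> j" for i j
    unfolding T_def using that by (intro Un_mono UN_mono) simp_all
  \<comment> \<open>The element \<open>es ! i\<close> is neither in \<open>D\<close> nor in the
    support of an earlier vector; it enters with \<open>Xs ! i\<close>.\<close>
  have T_less: "T i \<subset> T j" if "i < j" "j \<le> ?k" for i j
  proof -
    have "es ! i \<in> set es"
      using that len by simp
    then have "es ! i \<notin> D"
      using D(2) by blast
    moreover have "es ! i \<notin> supp E (Xs ! l)" if "l < i" for l
      using es[of i l] that \<open>i < j\<close> \<open>j \<le> ?k\<close> by simp
    ultimately have "es ! i \<notin> T i"
      unfolding T_def by blast
    moreover have "es ! i \<in> supp E (Xs ! i)"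
      using es[of i i] that by simp
    then have "es ! i \<in> T j"
      unfolding T_def using that(1) by blast
    moreover have "T i \<subseteq> T j"
      using T_mono that(1) by simp
    ultimately show ?thesis
      by blast
  qed
  have T_U: "T i \<subset> ?U" if "i \<le> ?k" for i
  proof -
    have "z \<notin> supp E (Xs ! l)" if "l < i" for l
      using z(2) that \<open>i \<le> ?k\<close> by simp
    then have "z \<notin> T i"
      using D(2) unfolding T_def by blast
    moreover have "z \<in> ?U"
      using z(1) by simp
    moreover have "supp E (Xs ! l) \<subseteq> ?U" if "l < i" for l
      using that \<open>i \<le> ?k\<close> by auto
    then have "T i \<subseteq> ?U"
      unfolding T_def using D(2) by blast
    ultimately show ?thesis
      by blast
  qed
  \<comment> \<open>Up to \<open>?U\<close> the chain has \<open>?k + 2\<close> steps: one to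
    \<open>D\<close>, one for each member of \<open>Xs\<close>, and a last one gaining
    \<open>z\<close>. The height is only \<open>?k + 1\<close>.\<close>
  define cs where "cs = {} # map T [0..<Suc ?k]"
  have empty_T: "{} \<subset> T i" for i
    using \<open>D \<noteq> {}\<close> unfolding T_def by blast
  have "\<Union>{} \<in> ?L"
    unfolding support_unions_def by (intro CollectI exI[of _ "{}"]) simp
  then have cs_L: "set cs \<subseteq> ?L"
    using T_L by (simp add: cs_def image_subset_iff del: upt_Suc)
  have "z \<in> ?U"
    using z(1) by simp
  then have "{} \<subset> ?U"
    by blast
  moreover have "sorted_wrt (\<subset>) (map T [0..<Suc ?k])"
    unfolding sorted_wrt_map
  proof (rule sorted_wrt_mono_rel[OF _ sorted_wrt_upt])
    fix i j
    assume "j \<in> set [0..<Suc ?k]" "i < j"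
    then show "T i \<subset> T j"
      by (intro T_less) auto
  qed
  ultimately have "sorted_wrt (\<subset>) (cs @ [?U])"
    unfolding cs_def append_Cons sorted_wrt.simps(2) sorted_wrt_append
    using T_U empty_T by (simp add: less_Suc_eq_le ball_Un del: upt_Suc)
  moreover have "?L \<subseteq> Pow E"
    by (auto simp: support_unions_def supp_def)
  ultimately have "length cs \<le> height ?L ?U"
    using length_le_height[OF finite_E _ cs_L] by blast
  then show False
    unfolding height by (simp add: cs_def)
qed

text \<open>Relations enter only through \<open>rel\<close>, whose bound on the entries of
  \<open>w\<close> outside \<open>ys\<close> grows with \<open>length Xs\<close>, so one argument
  serves both versions of the axiom.\<close>

lemma modular_elimination:
  assumes len: "length es = length Xs"
    and modular: "modular_family E \<C> (Xs @ [X])"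
    and not_subset: "\<not> supp E X \<subseteq> (\<Union>Y\<in>set Xs. supp E Y)"
    and es_mem: "\<And>i. i < length Xs \<Longrightarrow> es ! i \<in> (supp E X \<inter> supp E (Xs ! i)) -
          (\<Union>j\<in>{..<length Xs} - {i}. supp E (Xs ! j))"
    and es_val: "\<And>i. i < length Xs \<Longrightarrow> X (es ! i) = - (Xs ! i) (es ! i)"
    and rel: "\<And>w ys. distinct w \<Longrightarrow> length w = r + 1 \<Longrightarrow> set w \<subseteq> E \<Longrightarrow>
          distinct ys \<Longrightarrow> length ys + 1 = r \<Longrightarrow> set ys \<subseteq> E \<Longrightarrow>
          card (set w - set ys) \<le> length Xs + 2 \<Longrightarrow> gp_relation r \<phi> w ys"
  shows "\<exists>Z\<in>\<C>. (\<forall>i<length Xs. Z (es ! i) = 0) \<and>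
           (\<forall>f\<in>E. Z f \<in> hsum (map (\<lambda>Y. Y f) (X # Xs)))"
proof -
  let ?k = "length Xs" and ?S = "\<lambda>i. supp E (Xs ! i)"
  let ?U = "\<Union>Y\<in>set (Xs @ [X]). supp E Y"
  obtain z where zX: "z \<in> supp E X" and z_Xs: "\<And>Y. Y \<in> set Xs \<Longrightarrow> z \<notin> supp E Y"
    using not_subset by blast
  have z_S: "z \<notin> ?S i" if "i < ?k" for i
    using z_Xs that by simp
  have es_S: "es ! i \<in> ?S j \<longleftrightarrow> i = j" if "i < ?k" "j < ?k" for i j
    using es_mem[OF that(1)] that by blast
  have es_X: "set es \<subseteq> supp E X"
    using es_mem len by (auto simp: in_set_conv_nth)
  have z_es: "z \<notin> set es"
    using z_S es_S len by (metis in_set_conv_nth)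
  have distinct_es: "distinct es"
    unfolding distinct_conv_nth using es_S len by metis
  have XsC: "Xs ! i \<in> \<C>" if "i < ?k" for i
    using modular that by (auto simp: modular_family_def)
  have XC: "X \<in> \<C>"
    using modular by (simp add: modular_family_def)
  have zE: "z \<in> E" and esE: "set es \<subseteq> E"
    using zX es_X by (auto simp: supp_def)
  define B0 where "B0 = ?U - insert z (set es)"
  obtain B where B: "B \<in> \<B>" and B0B: "B0 \<subseteq> B"
    using modular_family_independent[OF modular len es_S zX z_Xs] unfolding B0_def by blast
  \<comment> \<open>The support of \<open>Xs ! i\<close> avoids \<open>z\<close> and all other
    members of \<open>es\<close>. Hence it is the fundamental circuit of \<open>es ! i\<close> over
    \<open>B\<close>.\<close>
  have S_B0: "?S i - {es ! i} \<subseteq> B0" if i: "i < ?k" for i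
  proof
    fix u
    assume u: "u \<in> ?S i - {es ! i}"
    then have "u \<noteq> z"
      using z_S[OF i] by blast
    moreover have "u \<notin> set es"
    proof
      assume "u \<in> set es"
      then obtain j where "j < ?k" "u = es ! j"
        using len by (metis in_set_conv_nth)
      then show False
        using es_S[of j i] i u by auto
    qed
    moreover have "u \<in> ?U"
      using u i by auto
    ultimately show "u \<in> B0"
      unfolding B0_def by blast
  qed
  have S_circuit: "?S i \<in> circuits E \<B>" if "i < ?k" for i
    using circuit_vector_supp XsC that by blast
  have X_circuit: "supp E X \<in> circuits E \<B>"
    using circuit_vector_supp XC by blast
  have es_B: "es ! i \<notin> B" if "i < ?k" for i
    using circuit_not_subset_basis[OF S_circuit[OF that] B] S_B0[OF that] B0B by blast
  have X_sub: "supp E X - {z} \<subseteq> B \<union> set es"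
    using B0B unfolding B0_def by auto
  obtain A0 where "A0 \<in> \<B>" "supp E X - {z} \<subseteq> A0"
    using circuit_delete_subset_basis[OF X_circuit zX] .
  \<comment> \<open>Confining \<open>A\<close> to \<open>B\<close> and \<open>es\<close> keeps the
    tuple \<open>z # w\<close> close to \<open>B\<close>, which later bounds the number of its
    entries outside \<open>ys\<close>.\<close>
  then obtain A where A: "A \<in> \<B>" "supp E X - {z} \<subseteq> A" "A \<subseteq> B \<union> set es"
    using matroid_basis_between[OF matroid finite_E _ B _ X_sub] by blast
  have zA: "z \<notin> A"
    using circuit_not_subset_basis[OF X_circuit A(1)] A(2) by blast
  \<comment> \<open>Otherwise \<open>z\<close> could be exchanged for an element of
    \<open>A\<close>, necessarily some \<open>es ! i\<close>, and the new basis would contain the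
    support of \<open>Xs ! i\<close>.\<close>
  have zB: "z \<notin> B"
  proof
    assume "z \<in> B"
    then obtain b where b: "b \<in> A - B" "insert b (B - {z}) \<in> \<B>"
      using matroid_basis_exchange[OF matroid B A(1)] zA by blast
    then have "b \<in> set es"
      using A(3) by blast
    then obtain i where i: "i < ?k" "b = es ! i"
      using len by (metis in_set_conv_nth)
    have "z \<notin> B0"
      unfolding B0_def by blast
    then have "?S i \<subseteq> insert b (B - {z})"
      using S_B0[OF i(1)] B0B i(2) by blast
    then show False
      using circuit_not_subset_basis[OF S_circuit[OF i(1)] b(2)] by blast
  qed
  have BE: "B \<subseteq> E" and card_B: "card B = r"
    using gp_basis_card[OF B] by blast+
  then have finite_B: "finite B"
    using finite_E finite_subset by blast
  have "dependent_wrt \<B> (insert z B)"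
    unfolding dependent_wrt_def
  proof
    assume "\<exists>B'\<in>\<B>. insert z B \<subseteq> B'"
    then obtain B' where B': "B' \<in> \<B>" "insert z B \<subseteq> B'"
      by blast
    then have "finite B'" "card B' = r"
      using gp_basis_card[OF B'(1)] finite_E finite_subset by blast+
    then have "card (insert z B) \<le> r"
      using B'(2) card_mono by metis
    then show False
      using zB finite_B card_B by simp
  qed
  then obtain C where C: "C \<in> circuits E \<B>" "C \<subseteq> insert z B"
    using dependent_contains_circuit[OF finite_E] zE BE by (metis insert_subset)
  have zC: "z \<in> C"
    using circuit_not_subset_basis[OF C(1) B] C(2) by blast
  have Xz: "X z \<noteq> 0"
    using zX by (simp add: supp_def)
  obtain Z where Z: "Z \<in> \<C>" "supp E Z = C" "Z z = X z"
    using circuit_vector_exists[OF C(1) zC Xz] .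
  have Z_eq_0: "Z f = 0" if "f \<in> E" "f \<notin> insert z B" for f
    using that Z(2) C(2) by (auto simp: supp_def)
  have Xs_eq_0: "(Xs ! i) f = 0" if "i < ?k" "f \<in> E" "f \<notin> B" "f \<noteq> es ! i" for i f
    using S_B0[OF that(1)] B0B that by (auto simp: supp_def)
  have X_eq_0: "X f = 0" if "f \<in> E" "f \<notin> insert z (B \<union> set es)" for f
    using X_sub that by (auto simp: supp_def)
  have Z_es: "Z (es ! i) = 0" if "i < ?k" for i
  proof -
    have "es ! i \<in> set es"
      using that len by simp
    then show ?thesis
      using Z_eq_0 es_B[OF that] z_es esE by blast
  qed
  have "finite A"
    using gp_basis_card[OF A(1)] finite_E finite_subset by blast
  then obtain w where w: "set w = A" "distinct w"
    using finite_distinct_list by blast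
  have "Z f \<in> hsum (map (\<lambda>Y. Y f) (X # Xs))" if fE: "f \<in> E" for f
  proof -
    \<comment> \<open>Only the first case needs a relation. At \<open>z\<close> all members of
      \<open>Xs\<close> vanish; at \<open>es ! i\<close> only \<open>X\<close> and
      \<open>Xs ! i\<close> can be nonzero, and they cancel; elsewhere all vectors vanish.\<close>
    consider "f \<in> B" | "f = z" | i where "i < ?k" "f = es ! i" | "f \<notin> insert z (B \<union> set es)"
      using len by (metis UnE in_set_conv_nth insertE)
    then show ?thesis
    proof cases
      case 1
      obtain ys where ys: "set ys = B - {f}" "distinct ys"
        using finite_distinct_list finite_B by blast
      have fys: "distinct (f # ys)" "set (f # ys) = B"
        using ys 1 by auto
      then have fys_basis: "f # ys \<in> tuples E r" "\<phi> (f # ys) \<noteq> 0"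
        using basis_list[of "f # ys"] B by auto
      then have lys: "length ys + 1 = r" and ysE: "set ys \<subseteq> E"
        by (auto simp: tuples_def)
      have w_tuple: "w \<in> tuples E r"
        using basis_list[OF w(2)] w(1) A(1) by simp
      have zw: "distinct (z # w)" "length (z # w) = r + 1" "set (z # w) \<subseteq> E"
        using w zA zE w_tuple by (auto simp: tuples_def)
      have "set (z # w) - set ys \<subseteq> set (z # f # es)"
        using w(1) A(3) ys(1) by auto
      then have "card (set (z # w) - set ys) \<le> card (set (z # f # es))"
        by (intro card_mono) auto
      also have "\<dots> \<le> ?k + 2"
        using card_length[of "z # f # es"] len by simp
      finally have "gp_relation r \<phi> (z # w) ys"
        using rel[OF zw ys(2) lys ysE] by blast
      moreover have "set w \<in> \<B>" "supp E X - {z} \<subseteq> set w"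
        using w A by simp_all
      ultimately have orth: "0 \<in> hsum (map (\<lambda>u. X u * \<phi> (u # ys)) (z # w))"
        using circuit_vector_orthogonal[OF XC zX w(2)] by blast
      let ?g = "\<lambda>u. X u * \<phi> (u # ys)"
      \<comment> \<open>A nonzero term requires \<open>u\<close> to be outside \<open>ys\<close> and
        in the support of \<open>X\<close>; such elements lie in both lists or in neither.\<close>
      have "u \<in> set (z # w) \<longleftrightarrow> u \<in> set (z # f # es)" if g: "?g u \<noteq> 0" for u
      proof
        assume u: "u \<in> set (z # w)"
        have "u \<notin> set ys"
        proof
          assume "u \<in> set ys"
          then have "\<phi> (u # ys) = 0"
            using lys ysE by (intro not_distinct_eq_0) (auto simp: tuples_def)
          then show False
            using g by simp
        qed
        then have "u = z \<or> u \<in> A \<and> \<not> (u \<in> B \<and> u \<noteq> f)"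
          using u w(1) ys(1) by auto
        then show "u \<in> set (z # f # es)"
          using A(3) by auto
      next
        assume "u \<in> set (z # f # es)"
        then have "u \<in> E"
          using zE fE esE by auto
        moreover have "X u \<noteq> 0"
          using g by auto
        ultimately have "u \<in> supp E X"
          by (simp add: supp_def)
        then have "u = z \<or> u \<in> A"
          using A(2) by blast
        then show "u \<in> set (z # w)"
          using w(1) by auto
      qed
      then have same: "{u \<in> set (z # w). ?g u \<noteq> 0} = {u \<in> set (z # f # es). ?g u \<noteq> 0}"
        by (intro Collect_cong) blast
      have "distinct (z # f # es)"
      proof -
        have "f \<notin> set es"
          using 1 es_B len by (metis in_set_conv_nth)
        then show ?thesis
          using distinct_es z_es zB 1 by auto
      qed
      then have eq: "hsum (map ?g (z # w)) = hsum (map ?g (z # f # es))"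
        by (rule hsum_map_cong_nonzero[OF zw(1) _ same])
      \<comment> \<open>This factor is taken out of every term. The ratio conditions turn the term
        at \<open>z\<close> into \<open>- Z f\<close>, as \<open>Z z = X z\<close>, and the one at
        \<open>es ! i\<close> into \<open>(Xs ! i) f\<close>, as \<open>X\<close> and
        \<open>Xs ! i\<close> are opposite there.\<close>
      let ?c = "\<phi> (f # ys)"
      have fys_B: "set (f # ys) \<in> \<B>"
        using fys(2) B by simp
      have Z_sub: "supp E Z - {z} \<subseteq> set (f # ys)"
        unfolding Z(2) fys(2) using C(2) by blast
      have "Z f * ?c = - ?g z"
        using circuit_vector_ratio[OF Z(1) _ fE fys(1) fys_B Z_sub] Z(2,3) zC by simp
      then have gz: "?g z = ?c * - Z f"
        by (metis hyperfield_minus_minus hyperfield_minus_mult_right mult.commute)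
      have g_es: "?g (es ! i) = ?c * (Xs ! i) f" if i: "i < ?k" for i
      proof -
        have "?S i - {es ! i} \<subseteq> set (f # ys)"
          unfolding fys(2) using S_B0[OF i] B0B by blast
        moreover have "es ! i \<in> ?S i"
          using es_S i by blast
        ultimately have "(Xs ! i) f * ?c = - ((Xs ! i) (es ! i) * \<phi> (es ! i # ys))"
          using circuit_vector_ratio[OF XsC[OF i] _ fE fys(1) fys_B] by blast
        then show ?thesis
          by (simp add: es_val[OF i] hyperfield_minus_simps mult.commute)
      qed
      have "map ?g es = map (\<lambda>Y. ?c * Y f) Xs"
        using len g_es by (intro nth_equalityI) simp_all
      then have "map ?g (z # f # es) = map ((*) ?c) (- Z f # map (\<lambda>Y. Y f) (X # Xs))"
        using gz by (simp add: mult.commute)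
      then have "0 \<in> hsum (map ((*) ?c) (- Z f # map (\<lambda>Y. Y f) (X # Xs)))"
        using orth eq by (simp only:)
      then show ?thesis
        unfolding zero_in_hsum_scale_iff[OF fys_basis(2)] zero_in_hsum_minus_Cons_iff .
    next
      case 2
      have "Y f = 0" if "Y \<in> set Xs" for Y
        using z_Xs[OF that] zE 2 by (simp add: supp_def)
      then have "hsum (map (\<lambda>Y. Y f) Xs) = {0}"
        by (intro hsum_zeros) auto
      then show ?thesis
        using Z(3) 2 by (simp add: hadd_commute[of _ 0] hadd_zero_left)
    next
      case 3
      have "f \<notin> B"
        using es_B 3 by blast
      have "es ! j \<noteq> f" if "j < ?k" "j \<noteq> i" for j
        using es_S[of i j] es_S[of j j] that 3 by auto
      then have "map (\<lambda>Y. Y f) Xs ! j = 0" if "j < ?k" "j \<noteq> i" for j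
        using Xs_eq_0[OF that(1) fE \<open>f \<notin> B\<close>] that by auto
      then have "hsum (map (\<lambda>Y. Y f) Xs) = {(Xs ! i) f}"
        using hsum_single_nonzero[of i "map (\<lambda>Y. Y f) Xs"] 3(1) by simp
      then have "0 \<in> hsum (- (Xs ! i) f # map (\<lambda>Y. Y f) Xs)"
        unfolding zero_in_hsum_minus_Cons_iff by simp
      moreover have "X f = - (Xs ! i) f" "Z f = 0"
        using es_val Z_es 3 by simp_all
      ultimately show ?thesis
        by simp
    next
      case 4
      have "(Xs ! i) f = 0" if "i < ?k" for i
      proof -
        have "es ! i \<in> set es"
          using that len by simp
        then show ?thesis
          using Xs_eq_0[OF that fE] 4 by blast
      qed
      then have "\<forall>x\<in>set (map (\<lambda>Y. Y f) (X # Xs)). x = 0"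
        using X_eq_0[OF fE 4] by (auto simp: in_set_conv_nth)
      then have "hsum (map (\<lambda>Y. Y f) (X # Xs)) = {0}"
        by (rule hsum_zeros)
      then show ?thesis
        using Z_eq_0[OF fE] 4 by blast
    qed
  qed
  then show ?thesis
    using Z(1) Z_es by blast
qed

text \<open>This is elimination with \<open>Xs = [Y]\<close>; the bound in \<open>rel\<close> is
  then three, which \<open>small_relation\<close> covers.\<close>

lemma weak_modular_elimination: "weak_modular_elimination E \<C>"
  unfolding weak_modular_elimination_def
proof (intro allI ballI impI)
  fix X Y e
  assume e: "e \<in> E" and XY: "modular_family E \<C> [X, Y] \<and> X e = - Y e \<and> X e \<noteq> 0"
  have modular: "modular_family E \<C> ([Y] @ [X])"
    using XY by (auto simp: modular_family_def insert_commute Un_commute)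
  have "X \<in> \<C>" "Y \<in> \<C>" "supp E X \<noteq> supp E Y"
    using XY by (auto simp: modular_family_def)
  \<comment> \<open>The axiom for pairs does not assume this non-inclusion; it holds because
    distinct circuits are never nested.\<close>
  then have "\<not> supp E X \<subseteq> supp E Y"
    using circuit_subset_eq[OF circuit_vector_supp circuit_vector_supp] by blast
  then have not_subset: "\<not> supp E X \<subseteq> (\<Union>Y\<in>set [Y]. supp E Y)"
    by simp
  have val: "X e = - Y e" and nz: "X e \<noteq> 0"
    using XY by blast+
  then have "Y e \<noteq> 0"
    by (simp add: hyperfield_minus_eq_0_iff)
  then have mem: "[e] ! i \<in> (supp E X \<inter> supp E ([Y] ! i)) -
      (\<Union>j\<in>{..<length [Y]} - {i}. supp E ([Y] ! j))" if "i < length [Y]" for i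
    using that e nz by (auto simp: supp_def)
  have "\<exists>Z\<in>\<C>. (\<forall>i<length [Y]. Z ([e] ! i) = 0) \<and>
      (\<forall>f\<in>E. Z f \<in> hsum (map (\<lambda>Y. Y f) (X # [Y])))"
  proof (rule modular_elimination[OF _ modular not_subset mem])
    show "X ([e] ! i) = - ([Y] ! i) ([e] ! i)" if "i < length [Y]" for i
      using that val by simp
    show "gp_relation r \<phi> w ys"
      if "distinct w" "length w = r + 1" "set w \<subseteq> E" "distinct ys" "length ys + 1 = r"
        "set ys \<subseteq> E" "card (set w - set ys) \<le> length [Y] + 2" for w ys
      using small_relation[OF that(1-6)] that(7) by simp
  qed simp_all
  then show "\<exists>Z\<in>\<C>. Z e = 0 \<and> (\<forall>f\<in>E. Z f \<in> X f \<boxplus> Y f)"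
    by (simp only: list.map hsum_pair) simp
qed

end

text \<open>The relation for \<open>a # bs\<close> and \<open>remove1 a as\<close>, with bases \<open>as\<close> and \<open>bs\<close>, has a nonzero
  term at \<open>a\<close> and hence another nonzero term, which is an exchange.\<close>

lemma grassmann_pluecker_matroid:
  assumes gp: "grassmann_pluecker E r \<phi>"
  shows "matroid_bases E r (gp_bases E r \<phi>)"
proof -
  interpret alternating_function E r \<phi>
    using gp by unfold_locales (simp add: grassmann_pluecker_def)
  have "\<exists>b\<in>B - A. insert b (A - {a}) \<in> gp_bases E r \<phi>"
    if A: "A \<in> gp_bases E r \<phi>" and B: "B \<in> gp_bases E r \<phi>" and a: "a \<in> A - B" for A B a
  proof (rule ccontr)
    assume no_exchange: "\<not> ?thesis"
    obtain as where as: "as \<in> tuples E r" "\<phi> as \<noteq> 0" "set as = A" "distinct as"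
      using A not_distinct_eq_0 unfolding gp_bases_def by blast
    obtain bs where bs: "bs \<in> tuples E r" "\<phi> bs \<noteq> 0" "set bs = B" "distinct bs"
      using B not_distinct_eq_0 unfolding gp_bases_def by blast
    define ys where "ys = remove1 a as"
    have ys: "distinct ys" "set ys = A - {a}" "mset (a # ys) = mset as"
      using as a by (auto simp: ys_def)
    have lys: "length ys + 1 = r"
      using arg_cong[OF ys(3), of size] as(1) by (simp add: tuples_def)
    have AE: "A \<subseteq> E" and aE: "a \<in> E"
      using as a by (auto simp: tuples_def)
    then have ysE: "set ys \<subseteq> E"
      using ys(2) by blast
    then have tup: "u # ys \<in> tuples E r" if "u \<in> E" for u
      using that lys by (simp add: tuples_def)
    have ays: "\<phi> (a # ys) \<noteq> 0"
      using permutation_nonzero[OF tup[OF aE] as(2) ys(3)] .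
    have w: "distinct (a # bs)" "length (a # bs) = r + 1" "set (a # bs) \<subseteq> E"
      using bs a aE by (auto simp: tuples_def)
    have "gp_relation r \<phi> (a # bs) ys"
      using gp w ys(1) lys ysE unfolding grassmann_pluecker_def by simp
    then have rel: "0 \<in> hsum (map (\<lambda>u. signed_minor \<phi> (a # bs) u * \<phi> (u # ys)) (a # bs))"
      using gp_relation_iff_signed_minor[OF w(1,2)] by blast
    have "\<phi> (u # ys) = 0" if u: "u \<in> B" for u
    proof (rule ccontr)
      assume "\<phi> (u # ys) \<noteq> 0"
      moreover have "u \<in> E"
        using u w(3) bs(3) by auto
      ultimately have "distinct (u # ys)" "set (u # ys) \<in> gp_bases E r \<phi>"
        using gp_basis_iff tup by blast+
      moreover from this have "u \<noteq> a" "u \<notin> A - {a}"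
        using u a ys(2) by auto
      ultimately have "u \<in> B - A" "insert u (A - {a}) \<in> gp_bases E r \<phi>"
        using u ys(2) by simp_all
      then show False
        using no_exchange by blast
    qed
    then have "\<forall>x\<in>set (map (\<lambda>u. signed_minor \<phi> (a # bs) u * \<phi> (u # ys)) bs). x = 0"
      using bs(3) by auto
    then have "hsum (map (\<lambda>u. signed_minor \<phi> (a # bs) u * \<phi> (u # ys)) bs) = {0}"
      by (rule hsum_zeros)
    then have "signed_minor \<phi> (a # bs) a * \<phi> (a # ys) = 0"
      using rel by (simp add: hadd_commute[of _ 0] hadd_zero_left)
    moreover have "signed_minor \<phi> (a # bs) a = \<phi> bs"
      using signed_minor_append[of "[]" a bs \<phi>] w(1) by simp
    ultimately show False
      using bs(2) ays by (simp add: hyperfield_mult_eq_0_iff)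
  qed
  moreover have "gp_bases E r \<phi> \<noteq> {}"
    using gp unfolding grassmann_pluecker_def gp_bases_def by blast
  moreover have "\<forall>B\<in>gp_bases E r \<phi>. B \<subseteq> E \<and> card B = r"
    using gp_basis_card by blast
  ultimately show ?thesis
    unfolding matroid_bases_def by blast
qed

text \<open>The weak relations are among the strong ones, so the content is that the supports form
  the bases of a matroid.\<close>

lemma grassmann_pluecker_imp_weak:
  assumes "grassmann_pluecker E r \<phi>"
  shows "weak_grassmann_pluecker E r \<phi>"
  using assms grassmann_pluecker_matroid[OF assms]
  by (simp add: grassmann_pluecker_def weak_grassmann_pluecker_def)

theorem theorem6p13:
  fixes E :: "'a set" and r :: nat and \<phi> :: "'a list \<Rightarrow> 'f::hyperfield"
  assumes "finite E"
  shows "(grassmann_pluecker E r \<phi> \<longrightarrow> strong_modular_elimination E (gp_circuits E r \<phi>)) \<and>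
         (weak_grassmann_pluecker E r \<phi> \<longrightarrow> weak_modular_elimination E (gp_circuits E r \<phi>))"
proof (intro conjI impI)
  assume gp: "grassmann_pluecker E r \<phi>"
  then interpret weak_gp_function E r \<phi>
    using assms grassmann_pluecker_imp_weak by unfold_locales
  \<comment> \<open>No bound on the entries of \<open>w\<close> outside \<open>ys\<close> appears
    here, so families of every length are covered.\<close>
  have rel: "gp_relation r \<phi> w ys"
    if "distinct w" "length w = r + 1" "set w \<subseteq> E" "distinct ys" "length ys + 1 = r" "set ys \<subseteq> E"
    for w ys
    using gp that unfolding grassmann_pluecker_def by simp
  show "strong_modular_elimination E (gp_circuits E r \<phi>)"
    unfolding strong_modular_elimination_def
  proof (intro allI impI, elim conjE)
    fix Xs :: "('a \<Rightarrow> 'f) list" and X es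
    assume len: "length es = length Xs" and modular: "modular_family E \<C> (Xs @ [X])"
      and not_subset: "\<not> supp E X \<subseteq> (\<Union>Y\<in>set Xs. supp E Y)"
      and es: "\<forall>i<length Xs.
           es ! i \<in> (supp E X \<inter> supp E (Xs ! i)) - (\<Union>j\<in>{..<length Xs} - {i}. supp E (Xs ! j)) \<and>
           X (es ! i) = - (Xs ! i) (es ! i) \<and> X (es ! i) \<noteq> 0"
    show "\<exists>Z\<in>\<C>. (\<forall>i<length Xs. Z (es ! i) = 0) \<and>
           (\<forall>f\<in>E. Z f \<in> hsum (map (\<lambda>Y. Y f) (X # Xs)))"
      by (rule modular_elimination[OF len modular not_subset
            es[rule_format, THEN conjunct1] es[rule_format, THEN conjunct2, THEN conjunct1] rel])
  qed
next
  assume "weak_grassmann_pluecker E r \<phi>"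
  then interpret weak_gp_function E r \<phi>
    using assms by unfold_locales
  show "weak_modular_elimination E (gp_circuits E r \<phi>)"
    by (rule weak_modular_elimination)
qed

end
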